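(* Let $S\subset\mathbb{R}$ be a measurable set and suppose that $|S_a|<a$ for some $a>0$, where $S_a:=(S+a\mathbb{Z})\cap[0,a]$ and $|\cdot|$ denotes Lebesgue measure. Then there is a uniformly discrete set $\Lambda\subset\mathbb{R}$ with uniform density $D(\Lambda)=a$ which is a uniqueness set for $Y_S$.
   Context: Fourier transform: $\hat f(t)=\int_{\mathbb{R}} e^{-2\pi i t x}f(x)\,dx$. $Y$ is the space of continuous functions $f$ on $\mathbb{R}$ with $\sup_{x\in\mathbb{R}}(1+x^2)|f(x)|<\infty$; $Y_S$ is the subspace of those $f\in Y$ with $\hat f=0$ outside $S$. A set $\Lambda\subset\mathbb{R}$ is uniformly discrete if $\inf\{|\lambda-\lambda'|:\lambda,\lambda'\in\Lambda,\lambda\neq\lambda'\}>0$. It has uniform density $D(\Lambda)$ if $\mathrm{Card}(\Lambda\cap(x,x+r))=rD(\Lambda)+o(r)$ uniformly in $x$ as $r\to\infty$. A set $\Lambda$ is a uniqueness set for a space of continuous functions if the only function in the space vanishing on $\Lambda$ is the zero function. *)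

theory Defs
  imports "HOL-Analysis.Analysis"
begin

definition fourier :: "(real \<Rightarrow> complex) \<Rightarrow> real \<Rightarrow> complex" where
  "fourier f t = integral\<^sup>L lborel (\<lambda>x. exp (- (2 * pi * \<i> * complex_of_real (t * x))) * f x)"

definition Y :: "(real \<Rightarrow> complex) set" where
  "Y = {f. continuous_on UNIV f \<and> (\<exists>C. \<forall>x. (1 + x\<^sup>2) * norm (f x) \<le> C)}"

definition Y_S :: "real set \<Rightarrow> (real \<Rightarrow> complex) set" where
  "Y_S S = {f \<in> Y. \<forall>t. t \<notin> S \<longrightarrow> fourier f t = 0}"

definition uniformly_discrete :: "real set \<Rightarrow> bool" where
  "uniformly_discrete \<Lambda> \<longleftrightarrow>
     (\<exists>\<delta>>0. \<forall>l\<in>\<Lambda>. \<forall>l'\<in>\<Lambda>. l \<noteq> l' \<longrightarrow> \<delta> \<le> \<bar>l - l'\<bar>)"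

definition has_uniform_density :: "real set \<Rightarrow> real \<Rightarrow> bool" where
  "has_uniform_density \<Lambda> D \<longleftrightarrow>
     (\<forall>\<epsilon>>0. \<exists>R. \<forall>r\<ge>R. \<forall>x.
        finite (\<Lambda> \<inter> {x<..<x+r}) \<and>
        \<bar>real (card (\<Lambda> \<inter> {x<..<x+r})) - r * D\<bar> \<le> \<epsilon> * r)"

definition uniqueness_set :: "real set \<Rightarrow> (real \<Rightarrow> complex) set \<Rightarrow> bool" where
  "uniqueness_set \<Lambda> F \<longleftrightarrow> (\<forall>f\<in>F. (\<forall>l\<in>\<Lambda>. f l = 0) \<longrightarrow> f = (\<lambda>_. 0))"

definition periodization :: "real set \<Rightarrow> real \<Rightarrow> real set" where
  "periodization S a = {s + a * real_of_int k | s k. s \<in> S} \<inter> {0..a}"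

end

theory Submission
  imports Defs "HOL-Probability.Sinc_Integral" "HOL-Real_Asymp.Real_Asymp"
begin

text \<open>
  Rescale so that \<open>a = 1\<close>. Let \<open>C\<close> be a compact subset of \<open>(0,1)\<close> of positive measure avoiding the
  periodized spectrum. For \<open>f\<close> in the space, Poisson summation shows that for every \<open>x\<close> the function with
  Fourier coefficients \<open>f(x + n)\<close> vanishes on \<open>C\<close>. By Szego's theorem \<open>z^n\<close>, \<open>n \<ge> N\<close>, spans a dense subspace of
  \<open>L^1([0,1] - C)\<close> for every \<open>N\<close>; so if \<open>f(x + n) = 0\<close> for all \<open>n\<close> in a sufficiently long block
  \<open>[N, M(N)]\<close>, with \<open>M\<close> depending only on \<open>C\<close>, then \<open>f(x + m) = O(1/N)\<close> for \<open>\<bar>m\<bar> \<le> N\<close>. Hence infinitely many such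
  blocks force \<open>f(x + m) = 0\<close> for all \<open>m\<close>. Cutting the positive integers into consecutive blocks
  and shifting each block by a rational of \<open>[0,1)\<close>, every rational being used infinitely often, gives a set of
  density \<open>1\<close> on which \<open>f = 0\<close> forces \<open>f = 0\<close> on all rationals.
\<close>

text \<open>Density 1 is what a single coset x + Z uses up, and the argument recovers f on a coset
  only from samples on that same coset, yet infinitely many cosets must be served. One-sidedness in
  Szego's theorem resolves this: samples on arbitrarily distant blocks suffice, so all cosets can
  share the positive half-line. The theorem applies because the weight that is 0 on \<open>C\<close>
  and 1 elsewhere has log integral minus infinity. The set must work for all f at once, so block
  lengths may depend on \<open>C\<close> only; the approximating polynomials do, and f enters later
  through one constant multiplying the error. An index \<bar>m\<bar> \<le> N is reached with
  exponent 2N, so that m + 2N lies in [N, 3N], and the block starting at N must extend past 3N by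
  the degree of the polynomial. Block starts therefore grow geometrically, so the points lost at
  block boundaries number O(log r) in a window of length r and leave the density unchanged.\<close>

section \<open>Shifted integers and uniform density\<close>

text \<open>Dropping the points just before a jump of \<open>\<theta>\<close> keeps the set separated although \<open>\<theta>\<close> may take
  values arbitrarily close to both \<open>0\<close> and \<open>1\<close>.\<close>

definition shifted_integers :: "(int \<Rightarrow> real) \<Rightarrow> real set" where
  "shifted_integers \<theta> = {of_int n + \<theta> n | n. \<theta> (n + 1) = \<theta> n}"

text \<open>Only the smaller index has to survive the deletion: its successor then carries the same
  shift, and for indices at distance two or more a difference of shifts below 1 cannot close the
  gap.\<close>

lemma shifted_integers_gap:
  fixes \<theta> :: "int \<Rightarrow> real"
  assumes range: "\<And>n. 0 \<le> \<theta> n \<and> \<theta> n < 1" and "\<theta> (m + 1) = \<theta> m" and "m < n"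
  shows "of_int m + \<theta> m + 1 \<le> of_int n + \<theta> n"
proof (cases "n = m + 1")
  case True
  then show ?thesis using assms(2) by simp
next
  case False
  with \<open>m < n\<close> have "m + 2 \<le> n" by simp
  then have "real_of_int m + 2 \<le> of_int n" by linarith
  moreover have "\<theta> m < 1" "0 \<le> \<theta> n" using range by auto
  ultimately show ?thesis by linarith
qed

lemma uniformly_discrete_shifted_integers:
  assumes range: "\<And>n. 0 \<le> \<theta> n \<and> \<theta> n < 1"
  shows "uniformly_discrete (shifted_integers \<theta>)"
  unfolding uniformly_discrete_def
proof (intro exI[of _ 1] conjI ballI impI)
  fix l l' assume "l \<in> shifted_integers \<theta>" "l' \<in> shifted_integers \<theta>" and ne: "l \<noteq> l'"
  then obtain m n where m: "l = of_int m + \<theta> m" "\<theta> (m + 1) = \<theta> m"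
    and n: "l' = of_int n + \<theta> n" "\<theta> (n + 1) = \<theta> n"
    unfolding shifted_integers_def by auto
  have "m \<noteq> n" using ne m n by auto
  then consider "m < n" | "n < m" by linarith
  then show "1 \<le> \<bar>l - l'\<bar>"
  proof cases
    case 1 then show ?thesis using shifted_integers_gap[of \<theta>, OF range m(2), of n] m n by linarith
  next
    case 2 then show ?thesis using shifted_integers_gap[of \<theta>, OF range n(2), of m] m n by linarith
  qed
qed auto

lemma uniformly_discrete_scale:
  assumes "uniformly_discrete \<Lambda>" and "a > 0"
  shows "uniformly_discrete ((\<lambda>x. x / a) ` \<Lambda>)"
proof -
  obtain \<delta> where d: "\<delta> > 0" "\<And>l l'. l \<in> \<Lambda> \<Longrightarrow> l' \<in> \<Lambda> \<Longrightarrow> l \<noteq> l' \<Longrightarrow> \<delta> \<le> \<bar>l - l'\<bar>"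
    using assms(1) unfolding uniformly_discrete_def by blast
  show ?thesis
    unfolding uniformly_discrete_def
  proof (intro exI[of _ "\<delta> / a"] conjI ballI impI)
    show "\<delta> / a > 0" using d(1) assms(2) by simp
    fix x y assume "x \<in> (\<lambda>x. x / a) ` \<Lambda>" "y \<in> (\<lambda>x. x / a) ` \<Lambda>" "x \<noteq> y"
    then obtain l l' where l: "x = l / a" "y = l' / a" "l \<in> \<Lambda>" "l' \<in> \<Lambda>" "l \<noteq> l'" by auto
    have "\<bar>x - y\<bar> = \<bar>l - l'\<bar> / a"
      using l(1,2) assms(2) by (simp add: diff_divide_distrib [symmetric])
    then show "\<delta> / a \<le> \<bar>x - y\<bar>"
      using d(2)[OF l(3,4,5)] assms(2) by (simp add: divide_right_mono)
  qed
qed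

lemma has_uniform_density_scale:
  assumes "has_uniform_density \<Lambda> D" and a: "a > 0"
  shows "has_uniform_density ((\<lambda>x. x / a) ` \<Lambda>) (a * D)"
  unfolding has_uniform_density_def
proof (intro allI impI)
  fix \<epsilon> :: real assume "\<epsilon> > 0"
  then have "\<epsilon> / a > 0" using a by simp
  then obtain R where R: "\<And>r x. r \<ge> R \<Longrightarrow> finite (\<Lambda> \<inter> {x<..<x+r}) \<and>
        \<bar>real (card (\<Lambda> \<inter> {x<..<x+r})) - r * D\<bar> \<le> \<epsilon> / a * r"
    using assms(1) unfolding has_uniform_density_def by blast
  show "\<exists>R. \<forall>r\<ge>R. \<forall>x. finite ((\<lambda>x. x / a) ` \<Lambda> \<inter> {x<..<x+r}) \<and>
        \<bar>real (card ((\<lambda>x. x / a) ` \<Lambda> \<inter> {x<..<x+r})) - r * (a * D)\<bar> \<le> \<epsilon> * r"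
  proof (intro exI[of _ "R / a"] allI impI)
    fix r x assume "R / a \<le> r"
    then have "R \<le> a * r" using a by (simp add: field_simps)
    note R' = R[OF this, of "a * x"]
    have iff: "l / a \<in> {x<..<x+r} \<longleftrightarrow> l \<in> {a*x<..<a*x+a*r}" for l
      using a by (simp add: pos_less_divide_eq pos_divide_less_eq algebra_simps)
    have eq: "(\<lambda>x. x / a) ` \<Lambda> \<inter> {x<..<x+r} = (\<lambda>x. x / a) ` (\<Lambda> \<inter> {a*x<..<a*x+a*r})"
    proof (intro equalityI subsetI)
      fix y assume "y \<in> (\<lambda>x. x / a) ` \<Lambda> \<inter> {x<..<x+r}"
      then obtain l where l: "l \<in> \<Lambda>" "y = l / a" "l / a \<in> {x<..<x+r}" by auto
      show "y \<in> (\<lambda>x. x / a) ` (\<Lambda> \<inter> {a*x<..<a*x+a*r})"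
        unfolding l(2) by (intro imageI IntI l(1) iffD1[OF iff l(3)])
    next
      fix y assume "y \<in> (\<lambda>x. x / a) ` (\<Lambda> \<inter> {a*x<..<a*x+a*r})"
      then obtain l where l: "l \<in> \<Lambda>" "y = l / a" "l \<in> {a*x<..<a*x+a*r}" by blast
      show "y \<in> (\<lambda>x. x / a) ` \<Lambda> \<inter> {x<..<x+r}"
        unfolding l(2) by (intro imageI IntI l(1) iffD2[OF iff l(3)])
    qed
    have card: "card ((\<lambda>x. x / a) ` (\<Lambda> \<inter> {a*x<..<a*x+a*r})) = card (\<Lambda> \<inter> {a*x<..<a*x+a*r})"
      using a by (intro card_image inj_onI) auto
    show "finite ((\<lambda>x. x / a) ` \<Lambda> \<inter> {x<..<x+r}) \<and>
        \<bar>real (card ((\<lambda>x. x / a) ` \<Lambda> \<inter> {x<..<x+r})) - r * (a * D)\<bar> \<le> \<epsilon> * r"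
      unfolding eq card using R' a by (simp add: ac_simps)
  qed
qed

section \<open>Counting the terms of a lacunary sequence in a window\<close>

lemma lacunary_less_double:
  fixes N :: "nat \<Rightarrow> nat"
  assumes "\<And>k. 2 * N k \<le> N (Suc k)" and "k < l"
  shows "2 * N k \<le> N l"
  using \<open>k < l\<close>
proof (induction l)
  case (Suc l)
  then show ?case using assms(1)[of l] by (cases "k = l") auto
qed simp

lemma lacunary_ge_power:
  fixes N :: "nat \<Rightarrow> nat"
  assumes "\<And>k. 2 * N k \<le> N (Suc k)" and "1 \<le> N 0"
  shows "2 ^ k \<le> N k"
proof (induction k)
  case (Suc k)
  then show ?case using assms(1)[of k] by simp
qed (use assms(2) in simp)

text \<open>If \<open>N k0\<close> is the first term in the window and \<open>N l\<close> a later
  one, their difference is at least half of \<open>N l\<close>, so \<open>N l\<close> is at most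
  2\<rho>. Every later index is thus at most 1 + log2 of \<rho>, wherever the window lies;
  \<open>k0\<close> itself has no such bound and is counted separately.\<close>

lemma card_lacunary_window:
  fixes N :: "nat \<Rightarrow> nat"
  assumes dbl: "\<And>k. 2 * N k \<le> N (Suc k)" and N0: "1 \<le> N 0" and \<rho>: "\<rho> \<ge> 1"
  shows "finite {k. u \<le> real (N k) \<and> real (N k) \<le> u + \<rho>} \<and>
         card {k. u \<le> real (N k) \<and> real (N k) \<le> u + \<rho>} \<le> log 2 \<rho> + 3"
proof (cases "{k. u \<le> real (N k) \<and> real (N k) \<le> u + \<rho>} = {}")
  case True
  have "0 \<le> log 2 \<rho>" using \<rho> by simp
  then show ?thesis unfolding True by simp
next
  case False
  let ?A = "{k. u \<le> real (N k) \<and> real (N k) \<le> u + \<rho>}"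
  define k0 where "k0 = (LEAST k. k \<in> ?A)"
  have k0: "k0 \<in> ?A" using False LeastI_ex[of "\<lambda>k. k \<in> ?A"] unfolding k0_def by blast
  have log0: "0 \<le> log 2 \<rho>" using \<rho> by simp
  have sub: "?A \<subseteq> insert k0 {..nat \<lfloor>log 2 \<rho>\<rfloor> + 1}"
  proof
    fix l assume l: "l \<in> ?A"
    have "k0 \<le> l" unfolding k0_def using l by (rule Least_le)
    show "l \<in> insert k0 {..nat \<lfloor>log 2 \<rho>\<rfloor> + 1}"
    proof (cases "l = k0")
      case False
      with \<open>k0 \<le> l\<close> have "k0 < l" by simp
      then have "2 * N k0 \<le> N l" by (rule lacunary_less_double[of N, OF dbl])
      then have "2 * real (N k0) \<le> real (N l)" by linarith
      moreover have "(2::real) ^ l \<le> real (N l)"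
        using lacunary_ge_power[of N, OF dbl N0, of l] by (metis of_nat_le_iff of_nat_numeral of_nat_power)
      moreover have "real (N l) - real (N k0) \<le> \<rho>" using l k0 by auto
      ultimately have "2 ^ l \<le> 2 * \<rho>" by linarith
      then have "log 2 (2 ^ l) \<le> log 2 (2 * \<rho>)" using \<rho> by (subst log_le_cancel_iff) auto
      then have "real l \<le> 1 + log 2 \<rho>" using \<rho> by (simp add: log_mult log_nat_power)
      then have "l \<le> nat \<lfloor>log 2 \<rho>\<rfloor> + 1" using log0 by linarith
      then show ?thesis by simp
    qed simp
  qed
  have fin: "finite ?A" by (rule finite_subset[OF sub]) simp
  have "card ?A \<le> card (insert k0 {..nat \<lfloor>log 2 \<rho>\<rfloor> + 1})"
    by (rule card_mono[OF _ sub]) simp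
  also have "\<dots> \<le> nat \<lfloor>log 2 \<rho>\<rfloor> + 3"
    by (rule order_trans[OF card_insert_le_m1]) auto
  finally have "real (card ?A) \<le> real (nat \<lfloor>log 2 \<rho>\<rfloor> + 3)" by linarith
  also have "\<dots> \<le> log 2 \<rho> + 3" using log0 by simp
  finally show ?thesis using fin by blast
qed

text \<open>The map n to n + \<theta>(n) moves points by less than 1, so apart from deletions a
  window of length r holds r points up to an error of 2. Deletions occur only just before a term of
  the lacunary sequence, which costs at most log2 r + 3; the two errors add up to the threshold
  \<open>log 2 r + 5\<close>.\<close>

lemma has_uniform_density_shifted_integers:
  fixes \<theta> :: "int \<Rightarrow> real" and N :: "nat \<Rightarrow> nat"
  assumes range: "\<And>n. 0 \<le> \<theta> n \<and> \<theta> n < 1"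
    and dbl: "\<And>k. 2 * N k \<le> N (Suc k)" and N0: "1 \<le> N 0"
    and jump: "\<And>n. \<theta> (n + 1) \<noteq> \<theta> n \<Longrightarrow> n + 1 \<in> range (\<lambda>k. int (N k))"
  shows "has_uniform_density (shifted_integers \<theta>) 1"
  unfolding has_uniform_density_def
proof (intro allI impI)
  fix \<epsilon> :: real assume e: "\<epsilon> > 0"
  have "eventually (\<lambda>r. log 2 r + 5 \<le> \<epsilon> * r) at_top"
    using e by real_asymp
  then obtain R0 where R0: "\<And>r. r \<ge> R0 \<Longrightarrow> log 2 r + 5 \<le> \<epsilon> * r"
    unfolding eventually_at_top_linorder by blast
  let ?G = "{n. \<theta> (n + 1) \<noteq> \<theta> n}"
  show "\<exists>R. \<forall>r\<ge>R. \<forall>x. finite (shifted_integers \<theta> \<inter> {x<..<x+r}) \<and>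
        \<bar>real (card (shifted_integers \<theta> \<inter> {x<..<x+r})) - r * 1\<bar> \<le> \<epsilon> * r"
  proof (intro exI[of _ "max R0 1"] allI impI)
    fix r x :: real assume "max R0 1 \<le> r"
    then have r: "R0 \<le> r" "1 \<le> r" by auto
    define J where "J = {n. n \<notin> ?G \<and> x < of_int n + \<theta> n \<and> of_int n + \<theta> n < x + r}"
    have im: "shifted_integers \<theta> \<inter> {x<..<x+r} = (\<lambda>n. of_int n + \<theta> n) ` J"
      unfolding shifted_integers_def J_def by auto
    have inj: "inj_on (\<lambda>n. of_int n + \<theta> n) J"
    proof (rule inj_onI)
      fix m n assume "m \<in> J" "n \<in> J" and eq: "of_int m + \<theta> m = of_int n + \<theta> n"
      then have "\<theta> (m + 1) = \<theta> m" "\<theta> (n + 1) = \<theta> n" unfolding J_def by auto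
      then show "m = n"
        using shifted_integers_gap[of \<theta>, OF range, of m n] shifted_integers_gap[of \<theta>, OF range, of n m] eq
        by (cases rule: linorder_cases[of m n]) auto
    qed
    have J1: "J \<subseteq> {\<lfloor>x\<rfloor>..\<lfloor>x + r\<rfloor>}"
    proof
      fix n assume "n \<in> J"
      then have "x < of_int n + \<theta> n" "of_int n + \<theta> n < x + r" unfolding J_def by auto
      moreover have "0 \<le> \<theta> n" "\<theta> n < 1" using range by auto
      ultimately have "x < of_int n + 1" "of_int n \<le> x + r" by linarith+
      then show "n \<in> {\<lfloor>x\<rfloor>..\<lfloor>x + r\<rfloor>}" by (simp add: le_floor_iff) linarith
    qed
    have J2: "{\<lfloor>x\<rfloor> + 1..\<lfloor>x + r\<rfloor> - 1} - ?G \<subseteq> J"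
    proof
      fix n assume n: "n \<in> {\<lfloor>x\<rfloor> + 1..\<lfloor>x + r\<rfloor> - 1} - ?G"
      then have "\<lfloor>x\<rfloor> + 1 \<le> n" "n \<le> \<lfloor>x + r\<rfloor> - 1" by auto
      then have "x < of_int n" "of_int n + 1 \<le> x + r" by linarith+
      moreover have "0 \<le> \<theta> n" "\<theta> n < 1" using range by auto
      ultimately have "x < of_int n + \<theta> n" "of_int n + \<theta> n < x + r" by linarith+
      then show "n \<in> J" using n unfolding J_def by auto
    qed
    have finJ: "finite J" by (rule finite_subset[OF J1]) simp
    have up: "real (card J) \<le> r + 2"
    proof -
      have "card J \<le> card {\<lfloor>x\<rfloor>..\<lfloor>x + r\<rfloor>}" by (rule card_mono[OF _ J1]) simp
      then have "real (card J) \<le> of_int (\<lfloor>x + r\<rfloor> - \<lfloor>x\<rfloor> + 1)" using r by simp linarith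
      then show ?thesis by linarith
    qed
    have low: "r - 2 - (log 2 r + 3) \<le> real (card J)"
    proof -
      let ?I = "{\<lfloor>x\<rfloor> + 1..\<lfloor>x + r\<rfloor> - 1}"
      \<comment> \<open>The window is shifted by 1 because a deleted index n satisfies n + 1 =
        N(k).\<close>
      let ?A = "{k. x + 1 \<le> real (N k) \<and> real (N k) \<le> x + 1 + r}"
      have A: "finite ?A" "card ?A \<le> log 2 r + 3"
        using card_lacunary_window[of N, OF dbl N0 r(2)] by blast+
      have "?I \<inter> ?G \<subseteq> (\<lambda>k. int (N k) - 1) ` ?A"
      proof
        fix n assume n: "n \<in> ?I \<inter> ?G"
        then obtain k where "n + 1 = int (N k)" using jump by blast
        then have k: "n = int (N k) - 1" by simp
        then have "\<lfloor>x\<rfloor> + 1 \<le> int (N k) - 1" "int (N k) - 1 \<le> \<lfloor>x + r\<rfloor> - 1" using n by auto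
        then have "k \<in> ?A" by simp linarith
        then show "n \<in> (\<lambda>k. int (N k) - 1) ` ?A" using k by blast
      qed
      then have "card (?I \<inter> ?G) \<le> card ?A"
        using A(1) by (meson card_image_le card_mono finite_imageI le_trans)
      moreover have "card ?I = card (?I \<inter> ?G) + card (?I - ?G)"
        by (rule card_Int_Diff) simp
      moreover have "card (?I - ?G) \<le> card J" by (rule card_mono[OF finJ J2])
      ultimately have "real (card ?I) \<le> real (card J) + (log 2 r + 3)" using A(2) by linarith
      moreover have "r - 2 \<le> real (card ?I)" by simp linarith
      ultimately show ?thesis by linarith
    qed
    have "\<bar>real (card J) - r\<bar> \<le> \<epsilon> * r"
      using up low R0[OF r(1)] r(2) by (smt (verit) zero_le_log_cancel_iff)
    then show "finite (shifted_integers \<theta> \<inter> {x<..<x+r}) \<and>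
        \<bar>real (card (shifted_integers \<theta> \<inter> {x<..<x+r})) - r * 1\<bar> \<le> \<epsilon> * r"
      unfolding im using finJ card_image[OF inj] by simp
  qed
qed

section \<open>The unit circle\<close>

definition circ :: "real \<Rightarrow> complex" where
  "circ t = cis (2 * pi * t)"

lemma circ_add: "circ (s + t) = circ s * circ t"
  by (simp add: circ_def cis_mult distrib_left)

lemma norm_circ [simp]: "norm (circ t) = 1"
  by (simp add: circ_def)

lemma circ_0 [simp]: "circ 0 = 1"
  by (simp add: circ_def)

lemma circ_nonzero [simp]: "circ t \<noteq> 0"
  by (metis norm_circ norm_zero zero_neq_one)

lemma circ_of_int [simp]: "circ (of_int n) = 1"
  by (simp add: circ_def cis_multiple_2pi)

lemma circ_of_int_mult [simp]: "circ (of_int m * of_int n) = 1"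
  by (metis circ_of_int of_int_mult)

lemma circ_of_nat_mult: "circ (of_nat n * t) = circ t ^ n"
  by (simp add: circ_def Complex.DeMoivre mult_ac)

lemma exp_eq_circ: "exp (- (2 * pi * \<i> * complex_of_real x)) = circ (- x)"
  by (simp add: circ_def cis_conv_exp mult_ac)

lemma continuous_on_circ [continuous_intros]:
  "continuous_on A f \<Longrightarrow> continuous_on A (\<lambda>x. circ (f x))"
  unfolding circ_def by (intro continuous_intros)

lemma circ_eq_circ_iff:
  assumes "s \<in> {0..1}" "t \<in> {0..1}"
  shows "circ s = circ t \<longleftrightarrow> s = t \<or> {s, t} = {0, 1}"
proof
  assume "circ s = circ t"
  then have "cis (2 * pi * s) = cis (2 * pi * t)" by (simp add: circ_def)
  then obtain n :: int where "2 * pi * s = 2 * pi * t + 2 * pi * of_int n"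
    using sin_cos_eq_iff[of "2 * pi * s" "2 * pi * t"] by (auto simp: complex_eq_iff)
  then have "2 * pi * (s - t - of_int n) = 0" by (simp add: algebra_simps)
  then have n: "s - t = of_int n" by simp
  with assms have "n = 0 \<or> n = 1 \<or> n = -1" by auto
  then show "s = t \<or> {s, t} = {0, 1}" using n assms by auto
next
  assume "s = t \<or> {s, t} = {0, 1}"
  moreover have "circ 1 = 1" using circ_of_int[of 1] by simp
  ultimately show "circ s = circ t" by (auto simp: doubleton_eq_iff)
qed

lemma circ_image: "circ ` {0..1} = sphere 0 1"
proof (intro equalityI subsetI)
  fix z :: complex assume "z \<in> sphere 0 1"
  then have "norm z = 1" by simp
  then obtain x where x: "0 \<le> x" "x < 2 * pi" "z = cis x"
    by (metis Arg2pi complex_norm_eq_1_exp cis_conv_exp complex_norm_eq_1_exp_eq mult.left_neutral of_real_1)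
  then have "z = circ (x / (2 * pi))" "x / (2 * pi) \<in> {0..1}" by (auto simp: circ_def)
  then show "z \<in> circ ` {0..1}" by blast
qed auto

section \<open>Laurent polynomials and continuous functions on the circle\<close>

text \<open>On the circle 1/z is the conjugate of z, so Re z and Im z are Laurent polynomials, and
  sums and products stay in the class once a common power of z clears denominators. This converts
  the polynomials in two real variables of Stone-Weierstrass into Laurent polynomials.\<close>

lemma real_polynomial_function_circle:
  fixes p :: "complex \<Rightarrow> real"
  assumes "real_polynomial_function p"
  shows "\<exists>Q N. \<forall>z. norm z = 1 \<longrightarrow> complex_of_real (p z) * z ^ N = poly Q z"
  using assms
proof induction
  case (linear f)
  interpret bounded_linear f by fact
  let ?a = "complex_of_real (f 1)" and ?b = "complex_of_real (f \<i>)"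
  \<comment> \<open>The coefficients come from Re z = (z + 1/z)/2 and Im z = -i(z - 1/z)/2,
    multiplied by z; the real-linear \<open>f\<close> is determined by its values at 1 and
    \<open>\<i>\<close>.\<close>
  have "complex_of_real (f z) * z ^ 1 = poly [:(?a + \<i> * ?b) / 2, 0, (?a - \<i> * ?b) / 2:] z"
    if z: "norm z = 1" for z
  proof -
    have inv: "z * cnj z = 1" using z by (simp add: complex_norm_square [symmetric])
    have "f z = f (Re z *\<^sub>R 1 + Im z *\<^sub>R \<i>)"
      by (rule arg_cong[of _ _ f]) (simp add: complex_eq_iff)
    then have "complex_of_real (f z) = of_real (Re z) * ?a + of_real (Im z) * ?b"
      by (simp add: add scale)
    also have "of_real (Re z) = (z + cnj z) / 2" by (simp add: complex_add_cnj)
    also have "of_real (Im z) = - (\<i> * (z - cnj z)) / 2" by (simp add: complex_eq_iff)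
    finally have fz: "complex_of_real (f z) = (z + cnj z) / 2 * ?a + (- (\<i> * (z - cnj z)) / 2) * ?b" .
    have "complex_of_real (f z) * z
       = (z * z + z * cnj z) / 2 * ?a + (- (\<i> * (z * z - z * cnj z)) / 2) * ?b"
      unfolding fz by (simp add: add_divide_distrib diff_divide_distrib algebra_simps)
    then show ?thesis unfolding inv by (simp add: field_simps)
  qed
  then show ?case by blast
next
  case (const c)
  show ?case by (rule exI[of _ "[:of_real c:]"], rule exI[of _ 0]) simp
next
  case (add f g)
  then obtain Q1 N1 Q2 N2 where
    *: "\<And>z. norm z = 1 \<Longrightarrow> complex_of_real (f z) * z ^ N1 = poly Q1 z"
       "\<And>z. norm z = 1 \<Longrightarrow> complex_of_real (g z) * z ^ N2 = poly Q2 z" by blast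
  show ?case
  proof (rule exI[of _ "Q1 * monom 1 N2 + Q2 * monom 1 N1"], rule exI[of _ "N1 + N2"],
      intro allI impI)
    fix z :: complex assume "norm z = 1"
    from *[OF this, symmetric] show "complex_of_real (f z + g z) * z ^ (N1 + N2) =
      poly (Q1 * monom 1 N2 + Q2 * monom 1 N1) z"
      by (simp add: poly_monom power_add algebra_simps)
  qed
next
  case (mult f g)
  then obtain Q1 N1 Q2 N2 where
    *: "\<And>z. norm z = 1 \<Longrightarrow> complex_of_real (f z) * z ^ N1 = poly Q1 z"
       "\<And>z. norm z = 1 \<Longrightarrow> complex_of_real (g z) * z ^ N2 = poly Q2 z" by blast
  show ?case
  proof (rule exI[of _ "Q1 * Q2"], rule exI[of _ "N1 + N2"], intro allI impI)
    fix z :: complex assume "norm z = 1"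
    from *[OF this, symmetric] show "complex_of_real (f z * g z) * z ^ (N1 + N2) = poly (Q1 * Q2) z"
      by (simp add: power_add algebra_simps)
  qed
qed

text \<open>Stone-Weierstrass gives a polynomial in the two real coordinates, whose real and
  imaginary parts are brought to one denominator. The quotient \<open>poly Q z / z ^ N\<close> is
  the encoding of a Laurent polynomial used throughout.\<close>

lemma Laurent_approximation_circle:
  fixes F :: "complex \<Rightarrow> complex"
  assumes "continuous_on (sphere 0 1) F" and "\<epsilon> > 0"
  obtains Q N where "\<And>z. norm z = 1 \<Longrightarrow> norm (F z - poly Q z / z ^ N) < \<epsilon>"
proof -
  obtain p where p: "polynomial_function p" "\<And>z. z \<in> sphere 0 1 \<Longrightarrow> norm (F z - p z) < \<epsilon>"
    using Stone_Weierstrass_polynomial_function[OF compact_sphere assms] by blast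
  have "real_polynomial_function (Re \<circ> p)" "real_polynomial_function (Im \<circ> p)"
    using p(1) bounded_linear_Re bounded_linear_Im unfolding polynomial_function_def by auto
  then obtain Q1 N1 Q2 N2 where
    *: "\<And>z. norm z = 1 \<Longrightarrow> complex_of_real (Re (p z)) * z ^ N1 = poly Q1 z"
       "\<And>z. norm z = 1 \<Longrightarrow> complex_of_real (Im (p z)) * z ^ N2 = poly Q2 z"
    by (metis comp_apply real_polynomial_function_circle)
  show thesis
  proof
    fix z :: complex assume z: "norm z = 1"
    then have "z \<noteq> 0" by auto
    have "p z * z ^ (N1 + N2) = poly (Q1 * monom 1 N2 + smult \<i> (Q2 * monom 1 N1)) z"
      using *[OF z, symmetric]
      by (subst complex_eq[of "p z"]) (simp add: poly_monom power_add algebra_simps)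
    then have "poly (Q1 * monom 1 N2 + smult \<i> (Q2 * monom 1 N1)) z / z ^ (N1 + N2) = p z"
      using \<open>z \<noteq> 0\<close> by (simp add: divide_eq_eq)
    then show "norm (F z - poly (Q1 * monom 1 N2 + smult \<i> (Q2 * monom 1 N1)) z / z ^ (N1 + N2)) < \<epsilon>"
      using p(2)[of z] z by simp
  qed
qed

text \<open>On the compact interval \<open>circ\<close> is a closed map onto the circle: the
  preimage of a closed set under the lifted function is the image of a compact set. The only points
  identified are 0 and 1, where periodicity makes the choice by \<open>SOME\<close>
  harmless.\<close>

lemma periodic_lift_to_circle:
  fixes \<Psi> :: "real \<Rightarrow> 'b::topological_space"
  assumes cont: "continuous_on {0..1} \<Psi>" and per: "\<Psi> 0 = \<Psi> 1"
  obtains F where "continuous_on (sphere 0 1) F" "\<And>t. t \<in> {0..1} \<Longrightarrow> F (circ t) = \<Psi> t"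
proof -
  define F where "F z = \<Psi> (SOME t. t \<in> {0..1} \<and> circ t = z)" for z
  have F: "F (circ t) = \<Psi> t" if t: "t \<in> {0..1}" for t
  proof -
    have "(SOME s. s \<in> {0..1} \<and> circ s = circ t) \<in> {0..1} \<and> circ (SOME s. s \<in> {0..1} \<and> circ s = circ t) = circ t"
      by (rule someI[of _ t]) (use t in auto)
    then show ?thesis
      unfolding F_def using circ_eq_circ_iff[of "SOME s. s \<in> {0..1} \<and> circ s = circ t" t] t per
      by (auto simp: doubleton_eq_iff)
  qed
  have "continuous_on (sphere 0 1) F"
    unfolding continuous_on_closed_invariant
  proof (intro allI impI)
    fix B :: "'b set" assume "closed B"
    have "closed ({0..1} \<inter> \<Psi> -` B)"
      using cont \<open>closed B\<close> by (intro continuous_closed_preimage) auto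
    then have "compact ({0..1} \<inter> \<Psi> -` B)"
      by (metis compact_Icc compact_Int_closed inf.idem inf_assoc)
    then have "compact (circ ` ({0..1} \<inter> \<Psi> -` B))"
      by (intro compact_continuous_image continuous_intros)
    then have "closed (circ ` ({0..1} \<inter> \<Psi> -` B))" by (rule compact_imp_closed)
    moreover have "circ ` ({0..1} \<inter> \<Psi> -` B) \<inter> sphere 0 1 = F -` B \<inter> sphere 0 1"
    proof (intro equalityI subsetI)
      fix z assume "z \<in> circ ` ({0..1} \<inter> \<Psi> -` B) \<inter> sphere 0 1"
      then obtain t where "t \<in> {0..1}" "\<Psi> t \<in> B" "z = circ t" by blast
      then show "z \<in> F -` B \<inter> sphere 0 1" using F[of t] by simp
    next
      fix z assume z: "z \<in> F -` B \<inter> sphere 0 1"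
      then have "z \<in> circ ` {0..1}" using circ_image by blast
      then obtain t where "t \<in> {0..1}" "z = circ t" by blast
      with z F[of t] show "z \<in> circ ` ({0..1} \<inter> \<Psi> -` B) \<inter> sphere 0 1" by simp
    qed
    ultimately show "\<exists>A. closed A \<and> A \<inter> sphere 0 1 = F -` B \<inter> sphere 0 1" by blast
  qed
  with F show thesis using that by blast
qed

section \<open>Integrals over the unit interval and uniqueness of Fourier coefficients\<close>

lemma finite_measure_restrict_unit_interval:
  assumes "A \<in> sets borel" "A \<subseteq> {0..1::real}"
  shows "finite_measure (restrict_space lborel A)"
proof
  have "emeasure (restrict_space lborel A) (space (restrict_space lborel A)) = emeasure lborel A"
    using assms by (simp add: emeasure_restrict_space space_restrict_space)
  also have "\<dots> \<le> emeasure lborel {0..1::real}" by (intro emeasure_mono) (use assms in auto)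
  finally show "emeasure (restrict_space lborel A) (space (restrict_space lborel A)) \<noteq> \<infinity>"
    by (auto simp: top_unique)
qed

lemma measurable_restrict_unit_interval:
  fixes f :: "real \<Rightarrow> 'b::topological_space"
  assumes "A \<subseteq> {0..1}" "continuous_on {0..1} f"
  shows "f \<in> borel_measurable (restrict_space lborel A)"
proof -
  have "f \<in> borel_measurable (restrict_space borel A)"
    using assms by (intro borel_measurable_continuous_on_restrict continuous_on_subset[OF assms(2)])
  then show ?thesis
    by (simp cong: measurable_cong_sets add: sets_restrict_space_cong[OF sets_lborel])
qed

lemma integrable_restrict_unit_interval:
  fixes f :: "real \<Rightarrow> 'b::{banach, second_countable_topology}"
  assumes A: "A \<in> sets borel" "A \<subseteq> {0..1}" and f: "continuous_on {0..1} f"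
  shows "integrable (restrict_space lborel A) f"
proof -
  interpret finite_measure "restrict_space lborel A"
    by (rule finite_measure_restrict_unit_interval[OF A])
  have "bounded (f ` {0..1})"
    using f by (intro compact_imp_bounded compact_continuous_image) auto
  then obtain B where B: "\<And>t. t \<in> {0..1} \<Longrightarrow> norm (f t) \<le> B"
    by (meson bounded_iff imageI)
  show ?thesis
  proof (rule integrable_const_bound[where B = B])
    show "AE x in restrict_space lborel A. norm (f x) \<le> B"
      using A B by (intro AE_I2) (auto simp: space_restrict_space)
    show "f \<in> borel_measurable (restrict_space lborel A)"
      by (rule measurable_restrict_unit_interval[OF A(2) f])
  qed
qed

lemmas integrable_unit_interval =
  integrable_restrict_unit_interval[of "{0..1}", simplified]

lemma integral_circ:
  fixes k :: int
  shows "(\<integral>t. circ (of_int k * t) \<partial>restrict_space lborel {0..1}) = (if k = 0 then 1 else 0)"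
proof (cases "k = 0")
  case True
  have "(\<integral>t. 1 \<partial>restrict_space lborel {0..1::real}) = (1 :: complex)"
    by (subst integral_restrict_space) (auto simp: integral_indicator)
  then show ?thesis using True by simp
next
  case False
  define w where "w = 2 * pi * of_int k * \<i>"
  have w: "w \<noteq> 0" using False by (simp add: w_def)
  have circ_exp: "circ (of_int k * t) = exp (of_real t * w)" for t
    by (simp add: circ_def cis_conv_exp w_def mult_ac)
  have "(\<integral>t. circ (of_int k * t) \<partial>restrict_space lborel {0..1})
      = (\<integral>t. indicator {0..1} t *\<^sub>R circ (of_int k * t) \<partial>lborel)"
    by (subst integral_restrict_space) auto
  also have "\<dots> = exp (of_real 1 * w) / w - exp (of_real 0 * w) / w"
  proof (rule integral_FTC_atLeastAtMost)
    fix t :: real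
    have "((\<lambda>t. exp (t * w) / w) has_field_derivative exp (of_real t * w)) (at (of_real t))"
      using w by (auto intro!: derivative_eq_intros)
    then have "((\<lambda>t. exp (of_real t * w) / w) has_vector_derivative exp (of_real t * w)) (at t)"
      by (rule has_vector_derivative_real_field)
    then show "((\<lambda>t. exp (of_real t * w) / w) has_vector_derivative circ (of_int k * t)) (at t within {0..1})"
      unfolding circ_exp by (rule has_vector_derivative_at_within)
  qed (auto intro!: continuous_intros)
  also have "\<dots> = 0"
    using circ_exp[of 1] by simp
  finally show ?thesis using False by simp
qed

lemma integral_poly_circ:
  fixes k :: int
  shows "(\<integral>t. poly Q (circ t) * circ (of_int k * t) \<partial>restrict_space lborel {0..1})
       = (if k \<le> 0 then coeff Q (nat (- k)) else 0)"
proof -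
  have circ: "circ t ^ i * circ (of_int k * t) = circ (of_int (int i + k) * t)" for i t
    by (simp add: circ_of_nat_mult [symmetric] circ_add [symmetric] distrib_right)
  have "(\<integral>t. poly Q (circ t) * circ (of_int k * t) \<partial>restrict_space lborel {0..1})
    = (\<integral>t. (\<Sum>i\<le>degree Q. coeff Q i * circ (of_int (int i + k) * t)) \<partial>restrict_space lborel {0..1})"
    by (intro Bochner_Integration.integral_cong)
       (simp_all add: poly_altdef sum_distrib_right mult.assoc circ)
  also have "\<dots> = (\<Sum>i\<le>degree Q. \<integral>t. coeff Q i * circ (of_int (int i + k) * t) \<partial>restrict_space lborel {0..1})"
    by (intro Bochner_Integration.integral_sum integrable_unit_interval continuous_intros)
  also have "\<dots> = (\<Sum>i\<le>degree Q. coeff Q i * (if int i + k = 0 then 1 else 0))"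
    by (intro sum.cong refl, subst integral_mult_right_zero, subst integral_circ) simp
  also have "\<dots> = (\<Sum>i\<le>degree Q. if i = nat (- k) \<and> k \<le> 0 then coeff Q i else 0)"
    by (intro sum.cong) auto
  also have "\<dots> = (if k \<le> 0 then coeff Q (nat (- k)) else 0)"
    by (auto simp: sum.delta coeff_eq_0)
  finally show ?thesis .
qed

text \<open>Let T be a trigonometric polynomial uniformly within \<epsilon> of the conjugate of
  \<Psi>. The integral of \<Psi> T is a combination of the vanishing coefficients, so the integral
  of |\<Psi>|^2 equals that of \<Psi> (conj \<Psi> - T) and is at most \<epsilon> times a bound for
  |\<Psi>|. Approximating the conjugate matches \<open>coeffs\<close>, which contains no
  conjugation.\<close>

lemma continuous_periodic_eq_0:
  fixes \<Psi> :: "real \<Rightarrow> complex"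
  assumes cont: "continuous_on {0..1} \<Psi>" and per: "\<Psi> 0 = \<Psi> 1"
    and coeffs: "\<And>k::int. (\<integral>t. \<Psi> t * circ (of_int k * t) \<partial>restrict_space lborel {0..1}) = 0"
    and t: "t \<in> {0..1}"
  shows "\<Psi> t = 0"
proof -
  let ?U = "restrict_space lborel {0..1::real}"
  obtain F where F: "continuous_on (sphere 0 1) F" "\<And>t. t \<in> {0..1} \<Longrightarrow> F (circ t) = \<Psi> t"
    using periodic_lift_to_circle[OF cont per] by blast
  have int: "integrable ?U (\<lambda>t. (norm (\<Psi> t))\<^sup>2)"
    by (intro integrable_unit_interval continuous_intros cont)
  have "bounded (\<Psi> ` {0..1})"
    using cont by (intro compact_imp_bounded compact_continuous_image) auto
  then obtain B where B: "B > 0" "\<And>t. t \<in> {0..1} \<Longrightarrow> norm (\<Psi> t) \<le> B"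
    unfolding bounded_pos by auto
  have le: "(\<integral>t. (norm (\<Psi> t))\<^sup>2 \<partial>?U) \<le> B * \<epsilon>" if \<epsilon>: "\<epsilon> > 0" for \<epsilon>
  proof -
    have "continuous_on (sphere 0 1) (\<lambda>z. cnj (F z))" by (intro continuous_intros F)
    then obtain Q N where Q: "\<And>z. norm z = 1 \<Longrightarrow> norm (cnj (F z) - poly Q z / z ^ N) < \<epsilon>"
      using Laurent_approximation_circle[OF _ \<epsilon>] by blast
    define T where "T t = poly Q (circ t) / circ t ^ N" for t
    have contT: "continuous_on {0..1} T"
      unfolding T_def by (intro continuous_intros) auto
    have T: "T t = (\<Sum>i\<le>degree Q. coeff Q i * circ (of_int (int i - int N) * t))" for t
    proof -
      have "circ t ^ i / circ t ^ N = circ (of_int (int i - int N) * t)" for i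
      proof -
        have "circ (of_int (int i - int N) * t) * circ t ^ N = circ t ^ i"
          unfolding circ_of_nat_mult [symmetric] circ_add [symmetric] by (simp add: algebra_simps)
        then show ?thesis by (metis circ_nonzero nonzero_mult_div_cancel_right power_not_zero)
      qed
      then show ?thesis
        unfolding T_def by (simp add: poly_altdef sum_divide_distrib times_divide_eq_right [symmetric]
            del: times_divide_eq_right)
    qed
    have "(\<integral>t. \<Psi> t * T t \<partial>?U) = (\<integral>t. (\<Sum>i\<le>degree Q. coeff Q i * (\<Psi> t * circ (of_int (int i - int N) * t))) \<partial>?U)"
      by (intro Bochner_Integration.integral_cong) (simp_all add: T sum_distrib_left mult_ac)
    also have "\<dots> = (\<Sum>i\<le>degree Q. \<integral>t. coeff Q i * (\<Psi> t * circ (of_int (int i - int N) * t)) \<partial>?U)"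
      by (intro Bochner_Integration.integral_sum integrable_unit_interval continuous_intros cont)
    also have "\<dots> = 0"
      by (intro sum.neutral ballI, subst integral_mult_right_zero, subst coeffs) simp
    finally have 0: "(\<integral>t. \<Psi> t * T t \<partial>?U) = 0" .
    have "complex_of_real (\<integral>t. (norm (\<Psi> t))\<^sup>2 \<partial>?U) = (\<integral>t. complex_of_real ((norm (\<Psi> t))\<^sup>2) \<partial>?U)"
      by (rule integral_complex_of_real [symmetric])
    also have "\<dots> = (\<integral>t. \<Psi> t * cnj (\<Psi> t) \<partial>?U)"
      by (simp only: complex_norm_square)
    also have "\<dots> = (\<integral>t. \<Psi> t * cnj (\<Psi> t) \<partial>?U) - (\<integral>t. \<Psi> t * T t \<partial>?U)" by (simp add: 0)
    also have "\<dots> = (\<integral>t. \<Psi> t * cnj (\<Psi> t) - \<Psi> t * T t \<partial>?U)"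
      by (intro Bochner_Integration.integral_diff [symmetric] integrable_unit_interval continuous_intros cont contT)
    finally have "(\<integral>t. (norm (\<Psi> t))\<^sup>2 \<partial>?U) \<le> norm (\<integral>t. \<Psi> t * cnj (\<Psi> t) - \<Psi> t * T t \<partial>?U)"
      by (metis abs_ge_self norm_of_real)
    also have "\<dots> \<le> (\<integral>t. norm (\<Psi> t * cnj (\<Psi> t) - \<Psi> t * T t) \<partial>?U)"
      by (rule integral_norm_bound)
    also have "\<dots> \<le> (\<integral>t. B * \<epsilon> \<partial>?U)"
    proof (rule integral_mono)
      fix t assume "t \<in> space ?U"
      then have t: "t \<in> {0..1}" by (simp add: space_restrict_space)
      have "norm (\<Psi> t * cnj (\<Psi> t) - \<Psi> t * T t) = norm (\<Psi> t) * norm (cnj (F (circ t)) - T t)"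
        unfolding F(2)[OF t] by (simp add: norm_mult [symmetric] right_diff_distrib)
      also have "\<dots> \<le> B * \<epsilon>"
        using B t Q[of "circ t"] by (intro mult_mono) (auto simp: T_def intro: less_imp_le)
      finally show "norm (\<Psi> t * cnj (\<Psi> t) - \<Psi> t * T t) \<le> B * \<epsilon>" .
    qed (intro integrable_unit_interval continuous_intros cont contT)+
    also have "\<dots> = B * \<epsilon>"
      by (subst integral_restrict_space) auto
    finally show ?thesis .
  qed
  have "(\<integral>t. (norm (\<Psi> t))\<^sup>2 \<partial>?U) \<le> 0"
  proof (rule field_le_epsilon)
    fix e :: real assume "e > 0"
    then show "(\<integral>t. (norm (\<Psi> t))\<^sup>2 \<partial>?U) \<le> 0 + e" using le[of "e / B"] B(1) by simp
  qed
  \<comment> \<open>The switch to the gauge integral gives access to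
    \<open>integral_eq_0_iff\<close>: a nonnegative continuous function with integral zero vanishes
    at every point, end points included.\<close>
  moreover have "(\<integral>t. (norm (\<Psi> t))\<^sup>2 \<partial>?U) = integral {0..1} (\<lambda>t. (norm (\<Psi> t))\<^sup>2)"
  proof (subst integral_restrict_space)
    have si: "set_integrable lborel {0..1} (\<lambda>t. (norm (\<Psi> t))\<^sup>2)"
      by (intro borel_integrable_atLeastAtMost' continuous_intros cont)
    show "(\<integral>t. indicator {0..1} t *\<^sub>R (norm (\<Psi> t))\<^sup>2 \<partial>lborel) = integral {0..1} (\<lambda>t. (norm (\<Psi> t))\<^sup>2)"
      using set_borel_integral_eq_integral(2)[OF si] by (simp add: set_lebesgue_integral_def)
  qed simp
  moreover have "integral {0..1} (\<lambda>t. (norm (\<Psi> t))\<^sup>2) \<ge> 0"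
    by (intro Henstock_Kurzweil_Integration.integral_nonneg integrable_continuous_interval continuous_intros cont) auto
  ultimately have "integral {0..1} (\<lambda>t. (norm (\<Psi> t))\<^sup>2) = 0" by linarith
  moreover have "continuous_on {0..1} (\<lambda>t. (norm (\<Psi> t))\<^sup>2)" by (intro continuous_intros cont)
  ultimately have "\<forall>t\<in>{0..1}. (norm (\<Psi> t))\<^sup>2 = 0"
    using integral_eq_0_iff[of 0 1 "\<lambda>t. (norm (\<Psi> t))\<^sup>2"] by simp
  then show ?thesis using t by simp
qed

section \<open>Poisson summation\<close>

text \<open>Pairing the indices k and -k - 1 turns the symmetric sum into a one-sided series, to
  which the Weierstrass M-test applies. The half-open range suits x in [0, 1], where x + k and x - k
  - 1 both have modulus at least k. The bound on the partial sums serves dominated convergence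
  later.\<close>

lemma symmetric_sum_uniform_limit:
  fixes v :: "int \<Rightarrow> 'x \<Rightarrow> complex"
  assumes pos: "\<And>k t. t \<in> A \<Longrightarrow> norm (v (int k) t) \<le> C / (1 + (real k)\<^sup>2)"
    and neg: "\<And>k t. t \<in> A \<Longrightarrow> norm (v (- int k - 1) t) \<le> C / (1 + (real k)\<^sup>2)"
  obtains l B where "uniform_limit A (\<lambda>n t. \<Sum>k=-int n..<int n. v k t) l sequentially"
    and "\<And>n t. t \<in> A \<Longrightarrow> norm (\<Sum>k=-int n..<int n. v k t) \<le> B"
proof -
  define u where "u k t = v (int k) t + v (- int k - 1) t" for k t
  define M where "M k = 2 * \<bar>C\<bar> / (1 + (real k)\<^sup>2)" for k :: nat
  have M0: "0 \<le> M k" for k by (simp add: M_def)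
  have "summable (\<lambda>k. 2 * \<bar>C\<bar> * inverse (real k ^ 2))"
    by (intro summable_mult inverse_power_summable) simp
  then have M: "summable M"
  \<comment> \<open>The comparison starts at 1 because the inverse of 0 is 0 and cannot dominate the
    first term.\<close>
  proof (rule summable_comparison_test'[of _ 1])
    fix k :: nat assume "1 \<le> k"
    then have "1 / (1 + (real k)\<^sup>2) \<le> inverse ((real k)\<^sup>2)"
      unfolding inverse_eq_divide
      by (intro divide_left_mono) (auto simp: zero_less_mult_iff add_pos_nonneg)
    then have "2 * \<bar>C\<bar> * (1 / (1 + (real k)\<^sup>2)) \<le> 2 * \<bar>C\<bar> * inverse ((real k)\<^sup>2)"
      by (intro mult_left_mono) auto
    then show "norm (M k) \<le> 2 * \<bar>C\<bar> * inverse (real k ^ 2)" using M0[of k] by (simp add: M_def)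
  qed
  have uM: "norm (u k t) \<le> M k" if "t \<in> A" for k t
  proof -
    have "norm (u k t) \<le> C / (1 + (real k)\<^sup>2) + C / (1 + (real k)\<^sup>2)"
      unfolding u_def using norm_triangle_mono[OF pos[OF that] neg[OF that]] .
    also have "\<dots> = 2 * C / (1 + (real k)\<^sup>2)" by simp
    also have "\<dots> \<le> M k" unfolding M_def by (intro divide_right_mono) auto
    finally show ?thesis .
  qed
  have sum_eq: "(\<Sum>k=-int n..<int n. v k t) = (\<Sum>k<n. u k t)" for n t
  proof (induction n)
    case (Suc n)
    have "{-int (Suc n)..<int (Suc n)} = insert (- int n - 1) (insert (int n) {-int n..<int n})"
      by auto
    then show ?case using Suc by (simp add: u_def)
  qed simp
  show thesis
  proof
    show "uniform_limit A (\<lambda>n t. \<Sum>k=-int n..<int n. v k t) (\<lambda>t. \<Sum>k. u k t) sequentially"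
      unfolding sum_eq by (rule Weierstrass_m_test[OF uM M])
    fix n t assume t: "t \<in> A"
    have "norm (\<Sum>k<n. u k t) \<le> (\<Sum>k<n. M k)" by (intro sum_norm_le uM t)
    also have "\<dots> \<le> suminf M" by (rule sum_le_suminf[OF M]) (auto simp: M0)
    finally show "norm (\<Sum>k=-int n..<int n. v k t) \<le> suminf M" unfolding sum_eq .
  qed
qed

lemma quadratic_decay_bound:
  fixes h :: "real \<Rightarrow> complex"
  assumes decay: "\<And>x. (1 + x\<^sup>2) * norm (h x) \<le> C" and "real k \<le> \<bar>y\<bar>"
  shows "norm (h y) \<le> C / (1 + (real k)\<^sup>2)"
proof -
  have "(real k)\<^sup>2 \<le> y\<^sup>2" using assms(2) by (metis abs_le_square_iff abs_of_nat)
  then have "(1 + (real k)\<^sup>2) * norm (h y) \<le> (1 + y\<^sup>2) * norm (h y)"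
    by (intro mult_right_mono) auto
  also have "\<dots> \<le> C" by (rule decay)
  finally show ?thesis by (simp add: pos_le_divide_eq add_pos_nonneg mult.commute)
qed

lemma integrable_quadratic_decay:
  fixes h :: "real \<Rightarrow> complex"
  assumes cont: "continuous_on UNIV h" and decay: "\<And>x. (1 + x\<^sup>2) * norm (h x) \<le> C"
  shows "integrable lborel h"
proof (rule Bochner_Integration.integrable_bound)
  have "integrable lborel (\<lambda>x::real. inverse (1 + x\<^sup>2))"
    using integrable_inverse_1_plus_square by (simp add: set_integrable_def einterval_def)
  then show "integrable lborel (\<lambda>x. C * inverse (1 + x\<^sup>2))" by (rule integrable_mult_right)
  show "h \<in> borel_measurable lborel" using cont by (simp add: borel_measurable_continuous_onI)
  have "norm (h x) \<le> C * inverse (1 + x\<^sup>2)" for x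
    using decay[of x] by (simp add: field_simps add_pos_nonneg)
  then show "AE x in lborel. norm (h x) \<le> norm (C * inverse (1 + x\<^sup>2))"
    by (intro AE_I2) (metis abs_ge_self order_trans real_norm_def)
qed

lemma integral_unit_interval_eq_integral:
  fixes f :: "real \<Rightarrow> complex"
  assumes "continuous_on {0..1} f"
  shows "(\<integral>t. f t \<partial>restrict_space lborel {0..1}) = integral {0..1} f"
proof -
  have "(\<integral>t. f t \<partial>restrict_space lborel {0..1}) = (\<integral>t. indicator {0..1} t *\<^sub>R f t \<partial>lborel)"
    by (rule integral_restrict_space) simp
  also have "\<dots> = integral {0..1} f"
    by (rule set_borel_integral_eq_integral(2)[OF borel_integrable_atLeastAtMost'[OF assms],
          unfolded set_lebesgue_integral_def])
  finally show ?thesis .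
qed

lemma integral_sum_translates:
  fixes w :: "real \<Rightarrow> complex"
  assumes cont: "continuous_on UNIV w"
  shows "(\<integral>t. (\<Sum>j=-int n..<int n. w (t + of_int j)) \<partial>restrict_space lborel {0..1})
       = integral {- real n..real n} w"
proof -
  have contS: "continuous_on A w" for A using cont continuous_on_subset by blast
  have cont': "continuous_on A (\<lambda>t. w (t + c))" for A c
    by (intro continuous_on_compose2[OF cont] continuous_intros) auto
  have int: "w integrable_on {a..b}" for a b by (rule integrable_continuous_interval[OF contS])
  have shift: "(\<integral>t. w (t + c) \<partial>restrict_space lborel {0..1}) = integral {c..c+1} w" for c
    using integral_shift_real_ivl[of c c "c + 1" w]
    by (simp add: integral_unit_interval_eq_integral[OF cont'])
  have "(\<integral>t. (\<Sum>j=-int n..<int n. w (t + of_int j)) \<partial>restrict_space lborel {0..1})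
      = (\<Sum>j=-int n..<int n. integral {of_int j..of_int j + 1} w)"
    by (subst Bochner_Integration.integral_sum)
       (auto intro!: integrable_unit_interval cont' simp: shift)
  also have "\<dots> = integral {- real n..real n} w"
  proof (induction n)
    case (Suc n)
    have "{-int (Suc n)..<int (Suc n)} = insert (- int n - 1) (insert (int n) {-int n..<int n})"
      by auto
    then have "(\<Sum>j=-int (Suc n)..<int (Suc n). integral {of_int j..of_int j + 1} w)
       = integral {- real n - 1..- real n} w + (integral {- real n..real n} w + integral {real n..real n + 1} w)"
      using Suc by simp
    also have "integral {- real n..real n} w + integral {real n..real n + 1} w
      = integral {- real n..real n + 1} w"
      by (rule Henstock_Kurzweil_Integration.integral_combine) (auto intro: int)
    also have "integral {- real n - 1..- real n} w + integral {- real n..real n + 1} w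
      = integral {- real n - 1..real n + 1} w"
      by (rule Henstock_Kurzweil_Integration.integral_combine) (auto intro: int)
    finally have step: "(\<Sum>j=-int (Suc n)..<int (Suc n). integral {of_int j..of_int j + 1} w)
       = integral {- real n - 1..real n + 1} w" .
    have "- real (Suc n) = - real n - 1" "real (Suc n) = real n + 1" by simp_all
    then show ?case using step by (simp only:)
  qed simp
  finally show ?thesis .
qed

lemma integral_symmetric_interval_tendsto:
  fixes w :: "real \<Rightarrow> complex"
  assumes cont: "continuous_on UNIV w" and int: "integrable lborel w"
  shows "(\<lambda>n. integral {- real n..real n} w) \<longlonglongrightarrow> (\<integral>x. w x \<partial>lborel)"
proof -
  have meas [measurable]: "w \<in> borel_measurable lborel"
    using int by (rule borel_measurable_integrable)
  have "(\<lambda>n. \<integral>x. indicator {- real n..real n} x *\<^sub>R w x \<partial>lborel) \<longlonglongrightarrow> (\<integral>x. w x \<partial>lborel)"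
  proof (rule integral_dominated_convergence[where w = "\<lambda>x. norm (w x)"])
    show "AE x in lborel. (\<lambda>n. indicator {- real n..real n} x *\<^sub>R w x) \<longlonglongrightarrow> w x"
    proof (rule AE_I2)
      fix x :: real
      have "eventually (\<lambda>n. indicator {- real n..real n} x *\<^sub>R w x = w x) sequentially"
        using eventually_ge_at_top[of "nat \<lceil>\<bar>x\<bar>\<rceil>"]
      proof eventually_elim
        case (elim n)
        then have "\<bar>x\<bar> \<le> real n" by linarith
        then show ?case by (simp add: indicator_def abs_le_iff)
      qed
      then show "(\<lambda>n. indicator {- real n..real n} x *\<^sub>R w x) \<longlonglongrightarrow> w x"
        by (rule tendsto_eventually)
    qed
  qed (use int in \<open>auto simp: indicator_def\<close>)
  moreover have "(\<integral>x. indicator {- real n..real n} x *\<^sub>R w x \<partial>lborel) = integral {- real n..real n} w" for n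
    by (rule set_borel_integral_eq_integral(2)[unfolded set_lebesgue_integral_def])
       (auto intro!: borel_integrable_atLeastAtMost' continuous_on_subset[OF cont])
  ultimately show ?thesis by simp
qed

text \<open>The translates sum to a continuous function l with l(0) = l(1). Since the exponentials
  are 1-periodic, unfolding the unit interval into the line identifies the Fourier coefficients of l
  with the integrals in \<open>coeffs\<close>. They all vanish, hence so does l, by uniqueness of
  coefficients rather than by convergence of a Fourier series.\<close>

lemma Poisson_sum_eq_0:
  fixes h :: "real \<Rightarrow> complex"
  assumes cont: "continuous_on UNIV h" and decay: "\<And>x. (1 + x\<^sup>2) * norm (h x) \<le> C"
    and coeffs: "\<And>k::int. (\<integral>x. h x * circ (of_int k * x) \<partial>lborel) = 0"
    and x: "x \<in> {0..1}"
  shows "(\<lambda>n. \<Sum>j=-int n..<int n. h (x + of_int j)) \<longlonglongrightarrow> 0"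
proof -
  let ?S = "\<lambda>n t. \<Sum>j=-int n..<int n. h (t + of_int j)"
  have cont': "continuous_on A (\<lambda>t. h (t + c))" for A c
    by (intro continuous_on_compose2[OF cont] continuous_intros) auto
  have b: "norm (h (t + of_int (int k))) \<le> C / (1 + (real k)\<^sup>2)"
          "norm (h (t + of_int (- int k - 1))) \<le> C / (1 + (real k)\<^sup>2)" if "t \<in> {0..1}" for t k
    by (rule quadratic_decay_bound[of h, OF decay]; use that in simp)+
  obtain l B where l: "uniform_limit {0..1} ?S l sequentially"
    and B: "\<And>n t. t \<in> {0..1} \<Longrightarrow> norm (?S n t) \<le> B"
    by (rule symmetric_sum_uniform_limit[of "{0..1}" "\<lambda>j t. h (t + of_int j)" C, OF b]) auto
  have contl: "continuous_on {0..1} l"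
    by (rule uniform_limit_theorem[OF _ l])
       (auto intro!: always_eventually continuous_intros cont')
  have lim: "(\<lambda>n. ?S n t) \<longlonglongrightarrow> l t" if "t \<in> {0..1}" for t
    by (rule tendsto_uniform_limitI[OF l that])
  \<comment> \<open>Periodicity appears only in the limit: the partial sums at 1 and 0 differ by the
    end terms h(n) - h(-n), which decay.\<close>
  have per: "l 0 = l 1"
  proof -
    have tel: "?S n 1 - ?S n 0 = h (real n) - h (- real n)" for n
    proof (induction n)
      case (Suc n)
      have "{-int (Suc n)..<int (Suc n)} = insert (- int n - 1) (insert (int n) {-int n..<int n})"
        by auto
      then have "?S (Suc n) 1 - ?S (Suc n) 0
          = (?S n 1 - ?S n 0) + (h (- real n) - h (- real n - 1)) + (h (1 + real n) - h (real n))"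
        by simp
      moreover have "- real (Suc n) = - real n - 1" "real (Suc n) = 1 + real n" by simp_all
      ultimately show ?case unfolding Suc by (simp only:) simp
    qed simp
    have "(\<lambda>n. h (real n) - h (- real n)) \<longlonglongrightarrow> 0"
    proof (rule Lim_null_comparison)
      have "norm (h (real n) - h (- real n)) \<le> 2 * (C / (1 + (real n)\<^sup>2))" for n
        using quadratic_decay_bound[of h C n "real n", OF decay]
          quadratic_decay_bound[of h C n "- real n", OF decay]
          norm_triangle_ineq4[of "h (real n)" "h (- real n)"] by simp
      then show "\<forall>\<^sub>F n in sequentially. norm (h (real n) - h (- real n)) \<le> 2 * (C / (1 + (real n)\<^sup>2))"
        by (intro always_eventually allI)
      show "(\<lambda>n. 2 * (C / (1 + (real n)\<^sup>2))) \<longlonglongrightarrow> 0" by real_asymp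
    qed
    then have "(\<lambda>n. ?S n 1 - ?S n 0) \<longlonglongrightarrow> 0" unfolding tel .
    moreover have "(\<lambda>n. ?S n 1 - ?S n 0) \<longlonglongrightarrow> l 1 - l 0"
      by (intro tendsto_diff lim) auto
    ultimately show ?thesis using LIMSEQ_unique by fastforce
  qed
  have "(\<integral>t. l t * circ (of_int k * t) \<partial>restrict_space lborel {0..1}) = 0" for k :: int
  proof -
    define w where "w y = h y * circ (of_int k * y)" for y
    have contw: "continuous_on UNIV w" unfolding w_def by (intro continuous_intros cont)
    have intw: "integrable lborel w"
      by (rule integrable_quadratic_decay[OF contw, of C])
         (use decay in \<open>simp add: w_def norm_mult\<close>)
    have Sw: "?S n t * circ (of_int k * t) = (\<Sum>j=-int n..<int n. w (t + of_int j))" for n t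
      by (simp add: w_def sum_distrib_right distrib_left circ_add)
    have lim1: "(\<lambda>n. \<integral>t. ?S n t * circ (of_int k * t) \<partial>restrict_space lborel {0..1})
        \<longlonglongrightarrow> (\<integral>t. l t * circ (of_int k * t) \<partial>restrict_space lborel {0..1})"
    proof (rule integral_dominated_convergence[where w = "\<lambda>_. B"])
      show "AE t in restrict_space lborel {0..1}. (\<lambda>n. ?S n t * circ (of_int k * t)) \<longlonglongrightarrow> l t * circ (of_int k * t)"
        by (intro AE_I2 tendsto_mult lim tendsto_const) (simp add: space_restrict_space)
      show "AE t in restrict_space lborel {0..1}. norm (?S n t * circ (of_int k * t)) \<le> B" for n
        using B by (intro AE_I2) (simp add: space_restrict_space norm_mult)
    qed (intro borel_measurable_integrable integrable_unit_interval continuous_intros contl cont')+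
    have lim2: "(\<lambda>n. \<integral>t. ?S n t * circ (of_int k * t) \<partial>restrict_space lborel {0..1}) \<longlonglongrightarrow> (\<integral>x. w x \<partial>lborel)"
      unfolding Sw integral_sum_translates[OF contw]
      by (rule integral_symmetric_interval_tendsto[OF contw intw])
    have "(\<integral>x. w x \<partial>lborel) = 0" unfolding w_def by (rule coeffs)
    then show ?thesis using LIMSEQ_unique[OF lim1 lim2] by simp
  qed
  then have "l x = 0" by (rule continuous_periodic_eq_0[OF contl per _ x])
  then show ?thesis using lim[OF x] by simp
qed

section \<open>One-sided approximation in the mean\<close>

text \<open>On the circle z^(-j) is the conjugate of z^j, so a z^(-j) has the same real part as
  conj(a) z^j. Folding the negative powers in this way leaves only nonnegative ones; splitting off
  the constant term makes \<open>G\<close> vanish at 0, so that the exponential of a multiple of it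
  is 1 there.\<close>

lemma Re_Laurent_eq_Re_poly:
  obtains G where "poly G 0 = 0"
    and "\<And>z. norm z = 1 \<Longrightarrow> Re (poly Q z / z ^ N) = Re (coeff Q N) + Re (poly G z)"
proof -
  define T where "T i = (if i = N then 0 else if N < i then monom (coeff Q i) (i - N)
     else monom (cnj (coeff Q i)) (N - i))" for i
  have T0: "poly (T i) 0 = 0" for i by (auto simp: T_def poly_monom)
  have T: "Re (coeff Q i * (z ^ i / z ^ N)) = (if i = N then Re (coeff Q N) else 0) + Re (poly (T i) z)"
    if z: "norm z = 1" for i z
  proof -
    have z0: "z \<noteq> 0" using z by auto
    consider "i = N" | "N < i" | "i < N" by linarith
    then show ?thesis
    proof cases
      case 1 then show ?thesis using z0 by (simp add: T_def)
    next
      case 2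
      then have "z ^ i / z ^ N = z ^ (i - N)" using z0 by (simp add: power_diff)
      then show ?thesis using 2 by (simp add: T_def poly_monom)
    next
      case 3
      have "z * cnj z = 1" using z by (simp add: complex_norm_square [symmetric])
      then have inv: "inverse z = cnj z" by (simp add: inverse_unique)
      have "z ^ i / z ^ N = inverse (z ^ (N - i))"
        using 3 z0 by (simp add: power_diff field_simps)
      also have "\<dots> = cnj (z ^ (N - i))" by (simp add: power_inverse [symmetric] inv)
      finally have "coeff Q i * (z ^ i / z ^ N) = cnj (cnj (coeff Q i) * z ^ (N - i))"
        by simp
      then have "Re (coeff Q i * (z ^ i / z ^ N)) = Re (cnj (coeff Q i) * z ^ (N - i))"
        by (simp only: cnj.sel)
      then show ?thesis using 3 by (simp add: T_def poly_monom)
    qed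
  qed
  show thesis
  proof
    show "poly (\<Sum>i\<le>degree Q. T i) 0 = 0" by (simp add: poly_sum T0)
    fix z :: complex assume z: "norm z = 1"
    have "Re (poly Q z / z ^ N) = (\<Sum>i\<le>degree Q. Re (coeff Q i * (z ^ i / z ^ N)))"
      by (simp add: poly_altdef sum_divide_distrib)
    also have "\<dots> = (\<Sum>i\<le>degree Q. if i = N then Re (coeff Q N) else 0) + (\<Sum>i\<le>degree Q. Re (poly (T i) z))"
      unfolding T[OF z] by (rule sum.distrib)
    also have "(\<Sum>i\<le>degree Q. if i = N then Re (coeff Q N) else 0) = Re (coeff Q N)"
      by (auto simp: coeff_eq_0)
    finally show "Re (poly Q z / z ^ N) = Re (coeff Q N) + Re (poly (\<Sum>i\<le>degree Q. T i) z)"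
      by (simp add: poly_sum)
  qed
qed

text \<open>Truncating the exponential series keeps the value at 0 exact, since
  \<open>poly G 0 = 0\<close> kills every term but the first. This exactness later makes 1 - q
  divisible by z.\<close>

lemma exp_poly_approximation_circle:
  fixes G :: "complex poly"
  assumes G0: "poly G 0 = 0" and \<delta>: "\<delta> > 0"
  obtains q where "poly q 0 = 1" "\<And>z. norm z = 1 \<Longrightarrow> norm (exp (poly G z) - poly q z) < \<delta>"
proof -
  have "compact (poly G ` sphere 0 1)"
    by (intro compact_continuous_image continuous_intros) auto
  then obtain R where R: "R > 0" "\<And>z. norm z = 1 \<Longrightarrow> norm (poly G z) \<le> R"
    using compact_imp_bounded[of "poly G ` sphere 0 1"] unfolding bounded_pos by (metis imageI mem_sphere_0)
  have "(\<lambda>n. inverse (fact n) * R ^ n) \<longlonglongrightarrow> 0" by (rule summable_LIMSEQ_zero[OF summable_exp])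
  then have "(\<lambda>n. exp R * R * (inverse (fact n) * R ^ n)) \<longlonglongrightarrow> exp R * R * 0" by (intro tendsto_intros)
  then have "eventually (\<lambda>n. exp R * R * (inverse (fact n) * R ^ n) < \<delta>) sequentially"
    using \<delta> by (intro order_tendstoD(2)) auto
  then obtain n where n: "exp R * R * (inverse (fact n) * R ^ n) < \<delta>"
    by (auto simp: eventually_sequentially)
  define q where "q = (\<Sum>k\<le>n. smult (1 / fact k) (G ^ k))"
  have q: "poly q z = (\<Sum>k\<le>n. poly G z ^ k / fact k)" for z
    by (simp add: q_def poly_sum)
  show thesis
  proof
    have "poly q 0 = (\<Sum>k\<le>n. if k = 0 then 1 else 0)"
      unfolding q G0 by (intro sum.cong) auto
    then show "poly q 0 = 1" by simp
    fix z :: complex assume "norm z = 1"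
    then have le: "norm (poly G z) \<le> R" by (rule R)
    have "norm (exp (poly G z) - poly q z) \<le> exp \<bar>Re (poly G z)\<bar> * norm (poly G z) ^ Suc n / fact n"
      unfolding q by (rule Taylor_exp)
    also have "\<dots> \<le> exp R * R ^ Suc n / fact n"
      using le abs_Re_le_cmod[of "poly G z"] R(1)
      by (intro divide_right_mono mult_mono power_mono) auto
    also have "\<dots> < \<delta>" using n by (simp add: field_simps)
    finally show "norm (exp (poly G z) - poly q z) < \<delta>" .
  qed
qed

text \<open>The functions max(0, 1 - n dist(z, circ C)) equal 1 on the image of \<open>C\<close> and
  tend to 0 elsewhere, so dominated convergence makes the integral off \<open>C\<close> small.
  Closedness gives a positive distance, and \<open>C\<close> lying in the open interval ensures that
  no point of [0, 1] outside \<open>C\<close>, end points included, is mapped into the image of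
  \<open>C\<close>.\<close>

lemma circle_bump:
  fixes C :: "real set"
  assumes C: "compact C" "C \<noteq> {}" "C \<subseteq> {0<..<1}" and \<eta>: "\<eta> > 0"
  obtains \<phi> :: "complex \<Rightarrow> real"
  where "continuous_on UNIV \<phi>" "\<And>z. 0 \<le> \<phi> z \<and> \<phi> z \<le> 1" "\<And>t. t \<in> C \<Longrightarrow> \<phi> (circ t) = 1"
    and "(\<integral>t. \<phi> (circ t) \<partial>restrict_space lborel ({0..1} - C)) < \<eta>"
proof -
  define K where "K = restrict_space lborel ({0..1} - C)"
  have borel: "{0..1} - C \<in> sets borel" using C(1) by (intro sets.Diff borel_closed compact_imp_closed) auto
  interpret finite_measure K
    unfolding K_def by (rule finite_measure_restrict_unit_interval[OF borel]) auto
  define \<phi> where "\<phi> n z = max 0 (1 - real n * infdist z (circ ` C))" for n z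
  have comp: "closed (circ ` C)" "circ ` C \<noteq> {}"
    using C by (auto intro!: compact_imp_closed compact_continuous_image continuous_intros)
  have cont: "continuous_on A (\<phi> n)" for A n
    unfolding \<phi>_def by (intro continuous_intros)
  have range: "0 \<le> \<phi> n z \<and> \<phi> n z \<le> 1" for n z
    by (auto simp: \<phi>_def infdist_nonneg)
  have one: "\<phi> n (circ t) = 1" if "t \<in> C" for n t
    using that by (simp add: \<phi>_def)
  have "(\<lambda>n. \<integral>t. \<phi> n (circ t) \<partial>K) \<longlonglongrightarrow> (\<integral>t. 0 \<partial>K)"
  proof (rule integral_dominated_convergence[where w = "\<lambda>_. 1"])
    show "AE t in K. (\<lambda>n. \<phi> n (circ t)) \<longlonglongrightarrow> 0"
    proof (rule AE_I2)
      fix t assume "t \<in> space K"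
      then have t: "t \<in> {0..1}" "t \<notin> C" by (auto simp: K_def space_restrict_space)
      have "circ t \<notin> circ ` C"
      proof
        assume "circ t \<in> circ ` C"
        then obtain s where s: "s \<in> C" "circ t = circ s" by blast
        then have "0 < s" "s < 1" using C(3) by auto
        with s t circ_eq_circ_iff[of t s] show False by (auto simp: doubleton_eq_iff)
      qed
      then have d: "infdist (circ t) (circ ` C) > 0"
        using comp by (meson infdist_pos_not_in_closed)
      have "eventually (\<lambda>n. \<phi> n (circ t) = 0) sequentially"
        using eventually_ge_at_top[of "nat \<lceil>1 / infdist (circ t) (circ ` C)\<rceil>"]
      proof eventually_elim
        case (elim n)
        then have "1 / infdist (circ t) (circ ` C) \<le> real n" by linarith
        then have "1 \<le> real n * infdist (circ t) (circ ` C)" using d by (simp add: field_simps)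
        then show ?case by (simp add: \<phi>_def)
      qed
      then show "(\<lambda>n. \<phi> n (circ t)) \<longlonglongrightarrow> 0" by (rule tendsto_eventually)
    qed
    show "(\<lambda>t. \<phi> n (circ t)) \<in> borel_measurable K" for n
      unfolding K_def
      by (rule measurable_restrict_unit_interval) (auto intro!: continuous_on_compose2[OF cont] continuous_intros)
    show "AE t in K. norm (\<phi> n (circ t)) \<le> 1" for n
      using range by (intro AE_I2) auto
  qed auto
  then have "eventually (\<lambda>n. (\<integral>t. \<phi> n (circ t) \<partial>K) < \<eta>) sequentially"
    using \<eta> by (intro order_tendstoD(2)) auto
  then obtain n where "(\<integral>t. \<phi> n (circ t) \<partial>K) < \<eta>" by (auto simp: eventually_sequentially)
  then show thesis using that[of "\<phi> n"] cont range one unfolding K_def by blast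
qed

text \<open>Take \<open>q = exp (L * G)\<close> with \<open>G(0) = 0\<close> and \<open>Re G\<close> close to the indicator of \<open>C\<close> minus its mean: then
  \<open>q(0) = 1\<close> while \<open>\<bar>q\<bar>\<close> is of order \<open>exp (- L * \<bar>C\<bar>)\<close> off \<open>C\<close>, and \<open>P = (1 - q) / z\<close> after truncating the
  exponential series.\<close>

lemma Szego_one_step:
  fixes C :: "real set"
  assumes C: "compact C" "C \<subseteq> {0<..<1}" "measure lborel C > 0" and \<epsilon>: "\<epsilon> > 0"
  obtains P where "(\<integral>t. norm (1 - circ t * poly P (circ t)) \<partial>restrict_space lborel ({0..1} - C)) < \<epsilon>"
proof -
  define K where "K = restrict_space lborel ({0..1} - C)"
  let ?U = "restrict_space lborel {0..1::real}"
  have ne: "C \<noteq> {}" using C(3) by auto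
  have borel: "{0..1} - C \<in> sets borel" using C(1) by (intro sets.Diff borel_closed compact_imp_closed) auto
  interpret finite_measure K
    unfolding K_def by (rule finite_measure_restrict_unit_interval[OF borel]) auto
  have intK: "integrable K f" if "continuous_on {0..1} f" for f :: "real \<Rightarrow> real"
    unfolding K_def by (rule integrable_restrict_unit_interval[OF borel _ that]) auto
  have K1: "measure K (space K) \<le> 1"
  proof -
    have "measure K (space K) = measure lborel ({0..1} - C)"
      unfolding K_def by (simp add: measure_restrict_space space_restrict_space borel)
    also have "\<dots> \<le> measure lborel {0..1::real}"
      by (intro measure_mono_fmeasurable) (auto simp: borel fmeasurable_def)
    finally show ?thesis by simp
  qed
  define c where "c = measure lborel C"
  have c: "c > 0" using C(3) by (simp add: c_def)
  \<comment> \<open>Chosen so that exp(-Lc/2) \<le> \<epsilon>/5; the maximum with 1 keeps L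
    positive when \<epsilon> \<ge> 5.\<close>
  define L where "L = max 1 (2 / c * ln (5 / \<epsilon>))"
  have L: "L > 0" by (simp add: L_def)
  have small: "2 * exp (- (L * c / 2)) \<le> 2 * \<epsilon> / 5"
  proof -
    have "ln (5 / \<epsilon>) \<le> L * c / 2" using c by (simp add: L_def field_simps max_def)
    then have "exp (- (L * c / 2)) \<le> exp (- ln (5 / \<epsilon>))" by simp
    also have "\<dots> = \<epsilon> / 5" using \<epsilon> by (simp add: exp_minus)
    finally show ?thesis by simp
  qed
  \<comment> \<open>L is fixed before \<phi>: off \<open>C\<close>, where \<phi> is still close to
    1, exp(L \<phi>) is close to exp L, and the bound exp(-L) on the integral of \<phi> offsets
    exactly this factor.\<close>
  obtain \<phi> :: "complex \<Rightarrow> real" where \<phi>: "continuous_on UNIV \<phi>" "\<And>z. 0 \<le> \<phi> z \<and> \<phi> z \<le> 1"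
      "\<And>t. t \<in> C \<Longrightarrow> \<phi> (circ t) = 1" "(\<integral>t. \<phi> (circ t) \<partial>K) < exp (- L)"
    unfolding K_def using circle_bump[OF C(1) ne C(2), of "exp (- L)"] by auto
  have cont\<phi>: "continuous_on {0..1} (\<lambda>t. \<phi> (circ t))"
    by (intro continuous_on_compose2[OF \<phi>(1)] continuous_intros) auto
  have "continuous_on (sphere 0 1) (\<lambda>z. complex_of_real (\<phi> z))"
    by (intro continuous_intros continuous_on_subset[OF \<phi>(1)]) auto
  \<comment> \<open>The tolerance c/4 is spent twice: it gives m \<ge> c - c/4 for the mean, and
    then Re G \<le> \<phi> - m + c/4 \<le> \<phi> - c/2.\<close>
  then obtain Q N where Q: "\<And>z. norm z = 1 \<Longrightarrow> norm (complex_of_real (\<phi> z) - poly Q z / z ^ N) < c / 4"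
    using Laurent_approximation_circle[of "\<lambda>z. complex_of_real (\<phi> z)" "c / 4"] c by auto
  obtain G where G: "poly G 0 = 0"
     "\<And>z. norm z = 1 \<Longrightarrow> Re (poly Q z / z ^ N) = Re (coeff Q N) + Re (poly G z)"
    using Re_Laurent_eq_Re_poly[of Q N] by blast
  define m where "m = Re (coeff Q N)"
  have Q': "\<bar>\<phi> z - (m + Re (poly G z))\<bar> < c / 4" if "norm z = 1" for z
    using Q[OF that] abs_Re_le_cmod[of "complex_of_real (\<phi> z) - poly Q z / z ^ N"] G(2)[OF that]
    by (simp add: m_def)
  have contG: "continuous_on A (\<lambda>t. poly p (circ t))" for A and p :: "complex poly"
    by (intro continuous_intros)
  have mean: "(\<integral>t. m + Re (poly G (circ t)) \<partial>?U) = m"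
  proof -
    have "(\<integral>t. poly G (circ t) \<partial>?U) = 0"
      using integral_poly_circ[of G 0] G(1) by (simp add: poly_0_coeff_0)
    then have "(\<integral>t. Re (poly G (circ t)) \<partial>?U) = 0"
      by (subst integral_Re) (auto intro!: integrable_unit_interval contG)
    moreover have "(\<integral>t. m \<partial>?U) = m" by (subst integral_restrict_space) auto
    ultimately show ?thesis
      by (subst Bochner_Integration.integral_add) (auto intro!: integrable_unit_interval continuous_intros)
  qed
  \<comment> \<open>m is the mean of m + Re G because G(0) = 0, and m + Re G + c/4 dominates \<phi>,
    hence the indicator of \<open>C\<close>.\<close>
  have m: "m \<ge> 3 * c / 4"
  proof -
    have "c = (\<integral>t. indicator C t \<partial>?U)"
    proof -
      have "(\<integral>t. (indicator C t :: real) \<partial>?U) = (\<integral>t. indicator ({0..1} \<inter> C) t \<partial>lborel)"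
        by (subst integral_restrict_space) (auto simp: indicator_inter_arith [abs_def] simp del: Bochner_Integration.integral_indicator)
      also have "{0..1} \<inter> C = C" using C(2) by auto
      finally show ?thesis by (simp add: c_def)
    qed
    also have "\<dots> \<le> (\<integral>t. c / 4 + (m + Re (poly G (circ t))) \<partial>?U)"
    proof (rule integral_mono)
      interpret U: finite_measure ?U by (rule finite_measure_restrict_unit_interval) auto
      have [measurable]: "C \<in> sets borel" using C(1) by (simp add: borel_closed compact_imp_closed)
      show "integrable ?U (indicator C :: real \<Rightarrow> real)"
        by (rule U.integrable_const_bound[where B = 1])
           (auto simp: indicator_def intro!: measurable_restrict_space1)
      show "indicator C t \<le> c / 4 + (m + Re (poly G (circ t)))" for t
      proof -
        have "indicator C t \<le> \<phi> (circ t)"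
          using \<phi>(2)[of "circ t"] \<phi>(3)[of t] by (auto simp: indicator_def)
        moreover have "\<phi> (circ t) - (m + Re (poly G (circ t))) < c / 4"
          using Q'[OF norm_circ, of t] by (simp only: abs_less_iff)
        ultimately show ?thesis by linarith
      qed
    qed (intro integrable_unit_interval continuous_intros)
    also have "\<dots> = c / 4 + m"
    proof -
      have "(\<integral>t. c / 4 + (m + Re (poly G (circ t))) \<partial>?U) = (\<integral>t. c / 4 \<partial>?U) + (\<integral>t. m + Re (poly G (circ t)) \<partial>?U)"
        by (intro Bochner_Integration.integral_add integrable_unit_interval continuous_intros)
      moreover have "(\<integral>t. c / 4 \<partial>?U) = c / 4" by (subst integral_restrict_space) auto
      ultimately show ?thesis using mean by simp
    qed
    finally show ?thesis by simp
  qed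
  have "poly (smult (of_real L) G) 0 = 0" using G(1) by simp
  then obtain q where q: "poly q 0 = 1"
     "\<And>z. norm z = 1 \<Longrightarrow> norm (exp (poly (smult (of_real L) G) z) - poly q z) < \<epsilon> / 5"
    using exp_poly_approximation_circle[of "smult (of_real L) G" "\<epsilon> / 5"] \<epsilon> by auto
  have "poly (1 - q) 0 = 0" using q(1) by simp
  then have "[:0, 1:] dvd 1 - q" using poly_eq_0_iff_dvd[of "1 - q" 0] by simp
  then obtain P where P: "1 - q = [:0, 1:] * P" by (rule dvdE)
  have P': "1 - z * poly P z = poly q z" for z
    using arg_cong[OF P, of "\<lambda>p. poly p z"] by (simp add: algebra_simps)
  have bound: "norm (poly q (circ t)) \<le> \<epsilon> / 5 + exp (- (L * c / 2)) * (1 + exp L * \<phi> (circ t))" for t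
  proof -
    let ?z = "circ t"
    have "norm (exp (poly (smult (of_real L) G) ?z)) = exp (L * Re (poly G ?z))" by simp
    also have "\<dots> \<le> exp (L * (\<phi> ?z - c / 2))"
    proof -
      have "m + Re (poly G ?z) - \<phi> ?z < c / 4"
        using Q'[OF norm_circ, of t] by (simp only: abs_less_iff minus_diff_eq)
      then have "Re (poly G ?z) \<le> \<phi> ?z - c / 2" using m by linarith
      then show ?thesis using L by simp
    qed
    also have "\<dots> = exp (- (L * c / 2)) * exp (L * \<phi> ?z)"
      by (simp add: exp_add [symmetric] algebra_simps)
    \<comment> \<open>Convexity of exp on [0, L] makes the bound linear in \<phi>, so that its
      integral involves only the integral of \<phi>.\<close>
    also have "\<dots> \<le> exp (- (L * c / 2)) * (1 + exp L * \<phi> ?z)"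
    proof (rule mult_left_mono)
      have "exp ((1 - \<phi> ?z) *\<^sub>R 0 + \<phi> ?z *\<^sub>R L) \<le> (1 - \<phi> ?z) * exp 0 + \<phi> ?z * exp L"
        using \<phi>(2)[of ?z] by (intro convex_onD[OF exp_convex]) auto
      also have "\<dots> \<le> 1 + exp L * \<phi> ?z" using \<phi>(2)[of ?z] by simp
      finally show "exp (L * \<phi> ?z) \<le> 1 + exp L * \<phi> ?z" by (simp add: mult.commute)
    qed simp
    finally show ?thesis
      using q(2)[of ?z] norm_triangle_ineq3[of "exp (poly (smult (of_real L) G) ?z)" "poly q ?z"] by simp
  qed
  have "(\<integral>t. norm (1 - circ t * poly P (circ t)) \<partial>K)
     \<le> (\<integral>t. (\<epsilon> / 5 + exp (- (L * c / 2))) + exp (- (L * c / 2)) * exp L * \<phi> (circ t) \<partial>K)"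
    unfolding P' using bound
    by (intro integral_mono intK continuous_intros cont\<phi>) (simp add: algebra_simps)
  also have "\<dots> = (\<integral>t. \<epsilon> / 5 + exp (- (L * c / 2)) \<partial>K) + (\<integral>t. exp (- (L * c / 2)) * exp L * \<phi> (circ t) \<partial>K)"
    by (intro Bochner_Integration.integral_add intK continuous_intros cont\<phi>)
  also have "\<dots> \<le> (\<epsilon> / 5 + exp (- (L * c / 2))) + exp (- (L * c / 2)) * exp L * exp (- L)"
  proof (rule add_mono)
    show "(\<integral>t. \<epsilon> / 5 + exp (- (L * c / 2)) \<partial>K) \<le> \<epsilon> / 5 + exp (- (L * c / 2))"
      using mult_right_mono[OF K1, of "\<epsilon> / 5 + exp (- (L * c / 2))"] \<epsilon> by simp
    show "(\<integral>t. exp (- (L * c / 2)) * exp L * \<phi> (circ t) \<partial>K) \<le> exp (- (L * c / 2)) * exp L * exp (- L)"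
      unfolding integral_mult_right_zero using \<phi>(4) by (intro mult_left_mono) auto
  qed
  also have "\<dots> = \<epsilon> / 5 + 2 * exp (- (L * c / 2))" by (simp add: exp_minus)
  also have "\<dots> < \<epsilon>" using small \<epsilon> by simp
  finally show thesis using that unfolding K_def by blast
qed

text \<open>Induction on d through 1 - z^(d+1) P P' = (1 - z^d P) + z^d P (1 - z P'). The factor P'
  comes from the one-step case and is chosen after P, with a tolerance divided by a bound for |P| on
  the circle.\<close>

lemma Szego_one_sided_approximation:
  fixes C :: "real set"
  assumes C: "compact C" "C \<subseteq> {0<..<1}" "measure lborel C > 0" and "\<epsilon> > 0"
  shows "\<exists>P. (\<integral>t. norm (1 - circ t ^ d * poly P (circ t)) \<partial>restrict_space lborel ({0..1} - C)) < \<epsilon>"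
  using \<open>\<epsilon> > 0\<close>
proof (induction d arbitrary: \<epsilon>)
  case 0
  then show ?case by (intro exI[of _ 1]) simp
next
  case (Suc d)
  define K where "K = restrict_space lborel ({0..1} - C)"
  have borel: "{0..1} - C \<in> sets borel" using C(1) by (intro sets.Diff borel_closed compact_imp_closed) auto
  have intK: "integrable K f" if "continuous_on {0..1} f" for f :: "real \<Rightarrow> real"
    unfolding K_def by (rule integrable_restrict_unit_interval[OF borel _ that]) auto
  obtain P where P: "(\<integral>t. norm (1 - circ t ^ d * poly P (circ t)) \<partial>K) < \<epsilon> / 2"
    using Suc.IH[of "\<epsilon> / 2"] Suc.prems unfolding K_def by auto
  have "compact (poly P ` sphere 0 1)"
    by (intro compact_continuous_image continuous_intros) auto
  then obtain B where B: "B > 0" "\<And>z. norm z = 1 \<Longrightarrow> norm (poly P z) \<le> B"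
    using compact_imp_bounded[of "poly P ` sphere 0 1"] unfolding bounded_pos by (metis imageI mem_sphere_0)
  have "\<epsilon> / (2 * B) > 0" using B Suc.prems by simp
  then obtain P' where P': "(\<integral>t. norm (1 - circ t * poly P' (circ t)) \<partial>K) < \<epsilon> / (2 * B)"
    using Szego_one_step[OF C] unfolding K_def by blast
  have "(\<integral>t. norm (1 - circ t ^ Suc d * poly (P * P') (circ t)) \<partial>K)
    \<le> (\<integral>t. norm (1 - circ t ^ d * poly P (circ t)) + B * norm (1 - circ t * poly P' (circ t)) \<partial>K)"
  proof (intro integral_mono intK continuous_intros)
    fix t
    let ?z = "circ t"
    have "1 - ?z ^ Suc d * poly (P * P') ?z
       = (1 - ?z ^ d * poly P ?z) + ?z ^ d * poly P ?z * (1 - ?z * poly P' ?z)"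
      by (simp add: algebra_simps)
    then have "norm (1 - ?z ^ Suc d * poly (P * P') ?z)
       \<le> norm (1 - ?z ^ d * poly P ?z) + norm (?z ^ d * poly P ?z * (1 - ?z * poly P' ?z))"
      by (metis norm_triangle_ineq)
    also have "norm (?z ^ d * poly P ?z * (1 - ?z * poly P' ?z)) \<le> B * norm (1 - ?z * poly P' ?z)"
      using B(2)[of ?z] by (simp add: norm_mult norm_power mult_right_mono)
    finally show "norm (1 - ?z ^ Suc d * poly (P * P') ?z)
       \<le> norm (1 - ?z ^ d * poly P ?z) + B * norm (1 - ?z * poly P' ?z)" by simp
  qed
  also have "\<dots> = (\<integral>t. norm (1 - circ t ^ d * poly P (circ t)) \<partial>K) + B * (\<integral>t. norm (1 - circ t * poly P' (circ t)) \<partial>K)"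
    by (subst Bochner_Integration.integral_add) (auto intro!: intK continuous_intros)
  also have "\<dots> < \<epsilon> / 2 + B * (\<epsilon> / (2 * B))"
    using P P' B(1) by (intro add_strict_mono mult_strict_left_mono) auto
  also have "\<dots> = \<epsilon>" using B(1) by simp
  finally show ?case unfolding K_def by blast
qed

section \<open>Uniqueness from samples\<close>

text \<open>Let \<Phi>(t) be the sum of g(x + j) e^(-2 pi i j t). Poisson summation for g modulated
  by t shows \<Phi> = 0 on \<open>C\<close>, while the coefficients of \<Phi> return the samples.
  Subtracting the weight z^d P(z) from 1 changes g(x + m) by a combination of vanishing samples
  only, which leaves an integral of \<Phi> (1 - z^d P) over the complement of \<open>C\<close>. The
  constant is a bound for |\<Phi>|, fixed before m, d and P.\<close>

lemma sample_bound:
  fixes g :: "real \<Rightarrow> complex"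
  assumes C: "compact C" "C \<subseteq> {0<..<1}"
    and cont: "continuous_on UNIV g" and decay: "\<And>y. (1 + y\<^sup>2) * norm (g y) \<le> D"
    and zero: "\<And>t (k::int). t \<in> C \<Longrightarrow> (\<integral>y. g y * circ (- ((t + of_int k) * y)) \<partial>lborel) = 0"
    and x: "x \<in> {0..1}"
  obtains B where "B \<ge> 0" and "\<And>m d P. (\<And>i. i \<le> degree P \<Longrightarrow> g (x + of_int (m + int d + int i)) = 0) \<Longrightarrow>
    norm (g (x + of_int m)) \<le>
      B * (\<integral>t. norm (1 - circ t ^ d * poly P (circ t)) \<partial>restrict_space lborel ({0..1} - C))"
proof -
  let ?U = "restrict_space lborel {0..1::real}"
  let ?S = "\<lambda>n t. \<Sum>j=-int n..<int n. g (x + of_int j) * circ (- (of_int j * t))"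
  define K where "K = restrict_space lborel ({0..1} - C)"
  have borel: "{0..1} - C \<in> sets borel" using C(1) by (intro sets.Diff borel_closed compact_imp_closed) auto
  have b: "norm (g (x + of_int (int k)) * circ (- (of_int (int k) * t))) \<le> D / (1 + (real k)\<^sup>2)"
          "norm (g (x + of_int (- int k - 1)) * circ (- (of_int (- int k - 1) * t))) \<le> D / (1 + (real k)\<^sup>2)"
    for t k
    unfolding norm_mult norm_circ mult_1_right
    by (rule quadratic_decay_bound[of g, OF decay]; use x in simp)+
  obtain \<Phi> B where lim: "uniform_limit UNIV ?S \<Phi> sequentially"
    and B: "\<And>n t. norm (?S n t) \<le> B"
    by (rule symmetric_sum_uniform_limit[of UNIV
          "\<lambda>j t. g (x + of_int j) * circ (- (of_int j * t))" D, OF b]) auto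
  have B0: "B \<ge> 0" using order_trans[OF norm_ge_zero B[of 0 0]] .
  have lim': "(\<lambda>n. ?S n t) \<longlonglongrightarrow> \<Phi> t" for t by (rule tendsto_uniform_limitI[OF lim]) simp
  have \<Phi>B: "norm (\<Phi> t) \<le> B" for t
    by (rule LIMSEQ_le_const2[OF tendsto_norm[OF lim']]) (use B in blast)
  have "continuous_on UNIV \<Phi>"
    by (rule uniform_limit_theorem[OF _ lim]) (auto intro!: always_eventually continuous_intros)
  then have cont\<Phi>: "continuous_on {0..1} \<Phi>" by (rule continuous_on_subset) simp
  have \<Phi>0: "\<Phi> t = 0" if t: "t \<in> C" for t
  proof -
    define h where "h y = g y * circ (- (t * y))" for y
    have "(\<lambda>n. \<Sum>j=-int n..<int n. h (x + of_int j)) \<longlonglongrightarrow> 0"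
    proof (rule Poisson_sum_eq_0[where C = D])
      show "continuous_on UNIV h" unfolding h_def by (intro continuous_intros cont)
      show "(1 + y\<^sup>2) * norm (h y) \<le> D" for y using decay[of y] by (simp add: h_def norm_mult)
      show "(\<integral>y. h y * circ (of_int k * y) \<partial>lborel) = 0" for k :: int
      proof -
        \<comment> \<open>The k-th integral for the modulated function is the transform of g at t -
          k, hence the instance \<open>- k\<close> of \<open>zero\<close>.\<close>
        have "h y * circ (of_int k * y) = g y * circ (- ((t + of_int (- k)) * y))" for y
          unfolding h_def mult.assoc circ_add [symmetric] by (simp add: algebra_simps)
        then show ?thesis using zero[OF t, of "- k"] by simp
      qed
    qed (rule x)
    moreover have "(\<Sum>j=-int n..<int n. h (x + of_int j)) = circ (- (t * x)) * ?S n t" for n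
      unfolding h_def sum_distrib_left
    proof (intro sum.cong refl)
      fix j :: int
      have "circ (- (t * (x + of_int j))) = circ (- (t * x)) * circ (- (of_int j * t))"
        unfolding circ_add [symmetric] by (simp add: algebra_simps)
      then show "g (x + of_int j) * circ (- (t * (x + of_int j)))
         = circ (- (t * x)) * (g (x + of_int j) * circ (- (of_int j * t)))" by simp
    qed
    ultimately have "(\<lambda>n. circ (- (t * x)) * ?S n t) \<longlonglongrightarrow> 0" by simp
    moreover have "(\<lambda>n. circ (- (t * x)) * ?S n t) \<longlonglongrightarrow> circ (- (t * x)) * \<Phi> t"
      by (intro tendsto_mult tendsto_const lim')
    ultimately have "circ (- (t * x)) * \<Phi> t = 0" using LIMSEQ_unique by blast
    then show ?thesis by simp
  qed
  have coeff: "(\<integral>t. \<Phi> t * circ (of_int m * t) \<partial>?U) = g (x + of_int m)" for m :: int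
  proof -
    have lim1: "(\<lambda>n. \<integral>t. ?S n t * circ (of_int m * t) \<partial>?U) \<longlonglongrightarrow> (\<integral>t. \<Phi> t * circ (of_int m * t) \<partial>?U)"
    proof (rule integral_dominated_convergence[where w = "\<lambda>_. B"])
      show "AE t in ?U. (\<lambda>n. ?S n t * circ (of_int m * t)) \<longlonglongrightarrow> \<Phi> t * circ (of_int m * t)"
        by (intro AE_I2 tendsto_mult lim' tendsto_const)
      show "AE t in ?U. norm (?S n t * circ (of_int m * t)) \<le> B" for n
        using B by (intro AE_I2) (simp add: norm_mult)
    qed (intro borel_measurable_integrable integrable_unit_interval continuous_intros cont\<Phi>)+
    have S: "(\<integral>t. ?S n t * circ (of_int m * t) \<partial>?U) = (if m \<in> {-int n..<int n} then g (x + of_int m) else 0)" for n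
    proof -
      have "?S n t * circ (of_int m * t) = (\<Sum>j=-int n..<int n. g (x + of_int j) * circ (of_int (m - j) * t))" for t
        unfolding sum_distrib_right mult.assoc circ_add [symmetric] by (simp add: algebra_simps)
      then have "(\<integral>t. ?S n t * circ (of_int m * t) \<partial>?U)
        = (\<integral>t. (\<Sum>j=-int n..<int n. g (x + of_int j) * circ (of_int (m - j) * t)) \<partial>?U)" by simp
      also have "\<dots> = (\<Sum>j=-int n..<int n. \<integral>t. g (x + of_int j) * circ (of_int (m - j) * t) \<partial>?U)"
        by (intro Bochner_Integration.integral_sum integrable_unit_interval continuous_intros)
      also have "\<dots> = (\<Sum>j=-int n..<int n. if j = m then g (x + of_int j) else 0)"
        unfolding integral_mult_right_zero integral_circ by (intro sum.cong) auto
      also have "\<dots> = (if m \<in> {-int n..<int n} then g (x + of_int m) else 0)"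
        by (simp only: sum.delta finite_atLeastLessThan_int)
      finally show ?thesis .
    qed
    have "eventually (\<lambda>n. (\<integral>t. ?S n t * circ (of_int m * t) \<partial>?U) = g (x + of_int m)) sequentially"
      using eventually_gt_at_top[of "nat \<bar>m\<bar>"]
    proof eventually_elim
      case (elim n)
      then have "m \<in> {-int n..<int n}" by auto
      then show ?case unfolding S by simp
    qed
    then have lim2: "(\<lambda>n. \<integral>t. ?S n t * circ (of_int m * t) \<partial>?U) \<longlonglongrightarrow> g (x + of_int m)"
      by (rule tendsto_eventually)
    show ?thesis by (rule LIMSEQ_unique[OF lim1 lim2])
  qed
  show thesis
  proof
    show "B \<ge> 0" by (rule B0)
    fix m :: int and d :: nat and P :: "complex poly"
    assume P: "\<And>i. i \<le> degree P \<Longrightarrow> g (x + of_int (m + int d + int i)) = 0"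
    define w where "w t = 1 - circ t ^ d * poly P (circ t)" for t
    have contw: "continuous_on A w" for A unfolding w_def by (intro continuous_intros)
    have "(\<integral>t. \<Phi> t * circ (of_int m * t) * (circ t ^ d * poly P (circ t)) \<partial>?U)
      = (\<integral>t. (\<Sum>i\<le>degree P. poly.coeff P i * (\<Phi> t * circ (of_int (m + int d + int i) * t))) \<partial>?U)"
    proof (rule Bochner_Integration.integral_cong)
      fix t
      have e: "circ (of_int (m + int d + int i) * t) = circ (of_int m * t) * circ t ^ d * circ t ^ i" for i
        unfolding circ_of_nat_mult [symmetric] circ_add [symmetric] by (simp add: algebra_simps)
      show "\<Phi> t * circ (of_int m * t) * (circ t ^ d * poly P (circ t))
        = (\<Sum>i\<le>degree P. poly.coeff P i * (\<Phi> t * circ (of_int (m + int d + int i) * t)))"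
        unfolding e poly_altdef sum_distrib_left by (simp only: mult_ac)
    qed simp
    also have "\<dots> = (\<Sum>i\<le>degree P. \<integral>t. poly.coeff P i * (\<Phi> t * circ (of_int (m + int d + int i) * t)) \<partial>?U)"
      by (intro Bochner_Integration.integral_sum integrable_unit_interval continuous_intros cont\<Phi>)
    also have "\<dots> = 0"
      unfolding integral_mult_right_zero coeff using P by (intro sum.neutral) auto
    finally have 0: "(\<integral>t. \<Phi> t * circ (of_int m * t) * (circ t ^ d * poly P (circ t)) \<partial>?U) = 0" .
    have "g (x + of_int m) = (\<integral>t. \<Phi> t * circ (of_int m * t) \<partial>?U)
       - (\<integral>t. \<Phi> t * circ (of_int m * t) * (circ t ^ d * poly P (circ t)) \<partial>?U)"
      by (simp only: coeff 0 diff_zero)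
    also have "\<dots> = (\<integral>t. \<Phi> t * circ (of_int m * t) - \<Phi> t * circ (of_int m * t) * (circ t ^ d * poly P (circ t)) \<partial>?U)"
      by (intro Bochner_Integration.integral_diff [symmetric] integrable_unit_interval continuous_intros cont\<Phi>)
    also have "\<dots> = (\<integral>t. \<Phi> t * circ (of_int m * t) * w t \<partial>?U)"
      by (simp add: w_def algebra_simps)
    also have "\<dots> = (\<integral>t. indicator {0..1} t *\<^sub>R (\<Phi> t * circ (of_int m * t) * w t) \<partial>lborel)"
      by (rule integral_restrict_space) simp
    \<comment> \<open>Here the vanishing of \<Phi> removes \<open>C\<close> from the domain, which
      is why approximation off \<open>C\<close> is enough.\<close>
    also have "\<dots> = (\<integral>t. indicator ({0..1} - C) t *\<^sub>R (\<Phi> t * circ (of_int m * t) * w t) \<partial>lborel)"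
      using \<Phi>0 by (intro Bochner_Integration.integral_cong) (auto simp: indicator_def)
    also have "\<dots> = (\<integral>t. \<Phi> t * circ (of_int m * t) * w t \<partial>K)"
      unfolding K_def by (rule integral_restrict_space [symmetric]) (simp add: borel)
    finally have "norm (g (x + of_int m)) \<le> (\<integral>t. norm (\<Phi> t * circ (of_int m * t) * w t) \<partial>K)"
      by (simp only: integral_norm_bound)
    also have "\<dots> \<le> (\<integral>t. B * norm (w t) \<partial>K)"
      unfolding K_def
    proof (intro integral_mono integrable_restrict_unit_interval borel continuous_intros cont\<Phi> contw)
      show "norm (\<Phi> t * circ (of_int m * t) * w t) \<le> B * norm (w t)" for t
        using \<Phi>B[of t] by (simp add: norm_mult mult_right_mono)
    qed auto
    also have "\<dots> = B * (\<integral>t. norm (w t) \<partial>K)" by simp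
    finally show "norm (g (x + of_int m)) \<le>
      B * (\<integral>t. norm (1 - circ t ^ d * poly P (circ t)) \<partial>restrict_space lborel ({0..1} - C))"
      unfolding w_def K_def .
  qed
qed

section \<open>Blocks and the universal sampling set\<close>

lemma block_index:
  fixes N :: "nat \<Rightarrow> nat"
  assumes N0: "N 0 = 1" and mono: "strict_mono N" and n: "(1::int) \<le> n"
  shows "\<exists>k. int (N k) \<le> n \<and> n < int (N (Suc k))"
proof -
  define k where "k = (GREATEST k. int (N k) \<le> n)"
  have bd: "k \<le> nat n" if "int (N k) \<le> n" for k
    using strict_mono_imp_increasing[OF mono, of k] that by linarith
  have "int (N k) \<le> n" unfolding k_def by (rule GreatestI_nat[of _ 0 "nat n"]) (use N0 n bd in auto)
  moreover have "\<not> int (N (Suc k)) \<le> n"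
  proof
    assume "int (N (Suc k)) \<le> n"
    then have "Suc k \<le> k" unfolding k_def by (rule Greatest_le_nat[of _ _ "nat n"]) (rule bd)
    then show False by simp
  qed
  ultimately show ?thesis by force
qed

lemma block_index_unique:
  fixes N :: "nat \<Rightarrow> nat"
  assumes mono: "strict_mono N" and "int (N k) \<le> n" "n < int (N (Suc k))"
    and "int (N l) \<le> n" "n < int (N (Suc l))"
  shows "k = l"
proof -
  have "N k < N (Suc l)" "N l < N (Suc k)" using assms by linarith+
  then show ?thesis using mono by (simp add: strict_mono_less)
qed

text \<open>Block k carries the shift q(j), j being the first component of the decoded k, so every
  rational of [0, 1) governs infinitely many blocks. A block of shift q(j) starting at p or later
  bounds g(q(j) + m) by B / (p + 1), where B depends on g and q(j) but not on the block.\<close>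

lemma universal_uniqueness_set:
  fixes C :: "real set"
  assumes C: "compact C" "C \<subseteq> {0<..<1}" "measure lborel C > 0"
  obtains \<Lambda> where "uniformly_discrete \<Lambda>" "has_uniform_density \<Lambda> 1"
    and "\<And>g D. \<lbrakk>continuous_on UNIV g; \<And>y. (1 + y\<^sup>2) * norm (g y) \<le> D;
      \<And>t (k::int). t \<in> C \<Longrightarrow> (\<integral>y. g y * circ (- ((t + of_int k) * y)) \<partial>lborel) = 0;
      \<And>l. l \<in> \<Lambda> \<Longrightarrow> g l = 0\<rbrakk> \<Longrightarrow> g = (\<lambda>_. 0)"
proof -
  let ?K = "restrict_space lborel ({0..1} - C)"
  have "\<forall>M::nat. \<exists>P. (\<integral>t. norm (1 - circ t ^ (2 * M) * poly P (circ t)) \<partial>?K) < 1 / (real M + 1)"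
    by (intro allI Szego_one_sided_approximation[OF C]) simp
  then obtain P where P: "\<And>M::nat. (\<integral>t. norm (1 - circ t ^ (2 * M) * poly (P M) (circ t)) \<partial>?K) < 1 / (real M + 1)"
    by metis
  \<comment> \<open>With M = N(k) and \<bar>m\<bar> \<le> M, the samples at m + 2M + i with i up to
    the degree lie in [M, 3M + degree]. The summand 3 also keeps the successor of the last index
    inside the block, so that none of these points is deleted; the factor 3 makes \<open>N\<close>
    lacunary.\<close>
  define N where "N = rec_nat 1 (\<lambda>_ M. 3 * M + degree (P M) + 3)"
  have N0: "N 0 = 1" and NS: "\<And>k. N (Suc k) = 3 * N k + degree (P (N k)) + 3"
    by (simp_all add: N_def)
  have mono: "strict_mono N" by (rule strict_mono_Suc_iff[THEN iffD2]) (simp add: NS)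
  define q :: "nat \<Rightarrow> real" where "q = from_nat_into (\<rat> \<inter> {0..<1})"
  have ne: "\<rat> \<inter> {0..<1::real} \<noteq> {}" by (metis Int_iff Rats_0 atLeastLessThan_iff empty_iff order_refl zero_less_one)
  have ctb: "countable (\<rat> \<inter> {0..<1::real})" using countable_rat by blast
  have range_q: "range q = \<rat> \<inter> {0..<1}" unfolding q_def by (rule range_from_nat_into[OF ne ctb])
  have q: "0 \<le> q j \<and> q j < 1" for j using range_q by (metis Int_iff atLeastLessThan_iff rangeI)
  obtain \<beta> where \<beta>: "\<And>n::int. 1 \<le> n \<Longrightarrow> int (N (\<beta> n)) \<le> n \<and> n < int (N (Suc (\<beta> n)))"
    using block_index[OF N0 mono] by metis
  have \<beta>_eq: "\<beta> n = k" if "int (N k) \<le> n" "n < int (N (Suc k))" for n k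
  proof -
    have "1 \<le> N k" using strict_mono_less_eq[OF mono, of 0 k] N0 by simp
    then have "1 \<le> n" using that(1) by linarith
    then show ?thesis using block_index_unique[OF mono _ _ that] \<beta> by blast
  qed
  \<comment> \<open>The default shift 0 fills the negative half-line with integers, since uniform
    density concerns windows there too.\<close>
  define \<theta> where "\<theta> n = (if 1 \<le> n then q (fst (prod_decode (\<beta> n))) else 0)" for n :: int
  have range: "0 \<le> \<theta> n \<and> \<theta> n < 1" for n unfolding \<theta>_def using q by simp
  have jump: "n + 1 \<in> range (\<lambda>k. int (N k))" if "\<theta> (n + 1) \<noteq> \<theta> n" for n
  proof (rule ccontr)
    assume notin: "n + 1 \<notin> range (\<lambda>k. int (N k))"
    have "\<theta> (n + 1) = \<theta> n"
    proof (cases "1 \<le> n")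
      case True
      have "n + 1 \<noteq> int (N (Suc (\<beta> n)))" using notin by blast
      with \<beta>[OF True] have "\<beta> (n + 1) = \<beta> n" by (intro \<beta>_eq) auto
      then show ?thesis using True by (simp add: \<theta>_def)
    next
      case False
      have "n + 1 \<noteq> int (N 0)" using notin by blast
      then show ?thesis using False N0 by (simp add: \<theta>_def)
    qed
    with that show False by simp
  qed
  show thesis
  proof
    show "uniformly_discrete (shifted_integers \<theta>)"
      by (rule uniformly_discrete_shifted_integers[of \<theta>, OF range])
    show "has_uniform_density (shifted_integers \<theta>) 1"
      by (rule has_uniform_density_shifted_integers[of \<theta> N, OF range _ _ jump]) (auto simp: NS N0)
    fix g D
    assume cont: "continuous_on UNIV g" and decay: "\<And>y. (1 + y\<^sup>2) * norm (g y) \<le> D"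
      and zero: "\<And>t (k::int). t \<in> C \<Longrightarrow> (\<integral>y. g y * circ (- ((t + of_int k) * y)) \<partial>lborel) = 0"
      and van: "\<And>l. l \<in> shifted_integers \<theta> \<Longrightarrow> g l = 0"
    have van': "g (q j + of_int m) = 0" for j and m :: int
    proof -
      have "q j \<in> {0..1}" using q[of j] by simp
      then obtain B where B: "B \<ge> 0" "\<And>m d P. (\<And>i. i \<le> degree P \<Longrightarrow> g (q j + of_int (m + int d + int i)) = 0) \<Longrightarrow>
         norm (g (q j + of_int m)) \<le> B * (\<integral>t. norm (1 - circ t ^ d * poly P (circ t)) \<partial>?K)"
        using sample_bound[OF C(1,2) cont decay zero] by blast
      have le: "norm (g (q j + of_int m)) \<le> B / (real p + 1)" if p: "nat \<bar>m\<bar> \<le> p" for p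
      proof -
        \<comment> \<open>Encoding the pair (j, p) yields a block of shift q(j) whose start is at
          least p.\<close>
        define k where "k = prod_encode (j, p)"
        have "p \<le> k" unfolding k_def by (rule le_prod_encode_2)
        also have "k \<le> N k" by (rule strict_mono_imp_increasing[OF mono])
        finally have pN: "p \<le> N k" .
        have "norm (g (q j + of_int m)) \<le> B * (\<integral>t. norm (1 - circ t ^ (2 * N k) * poly (P (N k)) (circ t)) \<partial>?K)"
        proof (rule B(2))
          fix i assume i: "i \<le> degree (P (N k))"
          define n where "n = m + int (2 * N k) + int i"
          have "\<bar>m\<bar> \<le> int (N k)" using p pN by linarith
          then have n: "int (N k) \<le> n" "n + 1 < int (N (Suc k))" using i by (auto simp: n_def NS)
          then have \<beta>n: "\<beta> n = k" "\<beta> (n + 1) = k" by (auto intro!: \<beta>_eq)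
          have "1 \<le> n" using n(1) strict_mono_less_eq[OF mono, of 0 k] N0 by simp
          then have "\<theta> n = q j" "\<theta> (n + 1) = q j" using \<beta>n by (auto simp: \<theta>_def k_def)
          then have "q j + of_int n \<in> shifted_integers \<theta>"
            unfolding shifted_integers_def by (intro CollectI exI[of _ n]) simp
          then show "g (q j + of_int (m + int (2 * N k) + int i)) = 0" using van unfolding n_def by blast
        qed
        also have "\<dots> \<le> B * (1 / (real (N k) + 1))"
          using P[of "N k"] B(1) by (intro mult_left_mono) auto
        also have "\<dots> \<le> B * (1 / (real p + 1))"
          using pN B(1) by (intro mult_left_mono divide_left_mono) auto
        finally show ?thesis by simp
      qed
      have "(\<lambda>p. B / (real p + 1)) \<longlonglongrightarrow> 0" by real_asymp
      then have "norm (g (q j + of_int m)) \<le> 0"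
        by (rule LIMSEQ_le_const) (use le in blast)
      then show ?thesis by simp
    qed
    have rat: "g r = 0" if "r \<in> \<rat>" for r
    proof -
      have "frac r \<in> \<rat> \<inter> {0..<1}"
        using that by (auto simp: frac_def frac_lt_1 intro!: Rats_diff) linarith
      then obtain j where "q j = frac r" using range_q by (metis imageE)
      then show ?thesis using van'[of j "\<lfloor>r\<rfloor>"] by (simp add: frac_def)
    qed
    show "g = (\<lambda>_. 0)"
    proof
      fix y
      show "g y = 0"
      proof (rule continuous_constant_on_closure[of \<rat> g 0 y])
        show "continuous_on (closure \<rat>) g" using cont by (rule continuous_on_subset) simp
        show "\<And>x. x \<in> \<rat> \<Longrightarrow> g x = 0" by (rule rat)
        show "y \<in> closure \<rat>" by (simp add: Rats_closure_real)
      qed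
    qed
  qed
qed

section \<open>Reduction to a compact spectral gap of positive measure\<close>

lemma periodization_measurable:
  assumes "S \<in> sets lebesgue"
  shows "periodization S a \<in> sets lebesgue"
proof -
  have "periodization S a = (\<Union>k::int. (\<lambda>s. a * of_int k + s) ` S) \<inter> {0..a}"
    unfolding periodization_def by (auto simp: add.commute)
  also have "\<dots> \<in> sets lebesgue"
  proof (intro sets.Int sets.countable_UN'')
    show "(\<lambda>s. a * of_int k + s) ` S \<in> sets lebesgue" for k :: int
      by (rule lebesgue_sets_translation[OF assms])
  qed auto
  finally show ?thesis .
qed

text \<open>Inner approximation by a closed set, with the whole measure of \<open>E\<close> as the
  strict bound for the loss, leaves positive measure. The compact set is Borel, which moves the
  problem from Lebesgue measurable sets to \<open>lborel\<close>.\<close>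

lemma compact_positive_measure_subset:
  fixes E :: "real set"
  assumes E: "E \<in> sets lebesgue" "bounded E" "emeasure lebesgue E > 0"
  obtains T where "compact T" "T \<subseteq> E" "measure lborel T > 0"
proof -
  have lm: "E \<in> lmeasurable" using E(1,2) by (simp add: bounded_set_imp_lmeasurable)
  have "emeasure lebesgue E = ennreal (measure lebesgue E)" by (rule emeasure_eq_measure2[OF lm])
  then have mE: "measure lebesgue E > 0" using E(3) by simp
  obtain T where T: "closed T" "T \<subseteq> E" "E - T \<in> lmeasurable"
      "emeasure lebesgue (E - T) < ennreal (measure lebesgue E)"
    using sets_lebesgue_inner_closed[OF E(1) mE] by blast
  have "ennreal (measure lebesgue (E - T)) < ennreal (measure lebesgue E)"
    using T(4) unfolding emeasure_eq_measure2[OF T(3)] .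
  then have less: "measure lebesgue (E - T) < measure lebesgue E"
    by (simp add: ennreal_less_iff)
  have cT: "compact T" using T E(2) by (meson bounded_subset compact_eq_bounded_closed)
  have "measure lebesgue (E - T) = measure lebesgue E - measure lebesgue T"
    by (rule measurable_measure_Diff[OF lm]) (use T cT in \<open>auto intro: lmeasurable_compact\<close>)
  then have "measure lebesgue T > 0" using less by linarith
  moreover have "measure lebesgue T = measure lborel T"
    using T(1) by (simp add: measure_completion)
  ultimately show thesis using that cT T(2) by simp
qed

theorem theorem4:
  fixes S :: "real set" and a :: real
  assumes "S \<in> sets lebesgue"
    and "a > 0"
    and "emeasure lebesgue (periodization S a) < ennreal a"
  shows "\<exists>\<Lambda>::real set. uniformly_discrete \<Lambda> \<and> has_uniform_density \<Lambda> a \<and>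
           uniqueness_set \<Lambda> (Y_S S)"
proof -
  note a = \<open>a > 0\<close>
  \<comment> \<open>The open interval keeps the rescaled set away from 0 and 1, which
    \<open>circ\<close> identifies.\<close>
  define E where "E = {0<..<a} - periodization S a"
  have pm: "periodization S a \<in> sets lebesgue" by (rule periodization_measurable[OF assms(1)])
  have E: "E \<in> sets lebesgue" unfolding E_def using pm by auto
  have "emeasure lebesgue E > 0"
  proof -
    have "ennreal a = emeasure lebesgue {0<..<a}" using a by simp
    also have "\<dots> \<le> emeasure lebesgue (E \<union> periodization S a)"
      using E pm by (intro emeasure_mono) (auto simp: E_def)
    also have "\<dots> \<le> emeasure lebesgue E + emeasure lebesgue (periodization S a)"
      by (rule emeasure_subadditive[OF E pm])
    finally show ?thesis using assms(3) by (metis add_0 leD not_gr_zero)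
  qed
  moreover have "bounded E" by (rule bounded_subset[of "{0..a}"]) (auto simp: E_def)
  ultimately obtain T where T: "compact T" "T \<subseteq> E" "measure lborel T > 0"
    using compact_positive_measure_subset[OF E] by blast
  define C where "C = (\<lambda>y. (1 / a) *\<^sub>R y) ` T"
  have C1: "compact C" unfolding C_def by (intro compact_scaling T)
  have C2: "C \<subseteq> {0<..<1}" using T(2) a by (auto simp: C_def E_def)
  have C3: "measure lborel C > 0"
  proof -
    have "measure lborel C = measure lebesgue C"
      using C1 by (simp add: measure_completion compact_imp_closed)
    also have "\<dots> = 1 / a * measure lebesgue T"
      using measure_lebesgue_affine[of "1 / a" 0 T] a by (simp add: C_def)
    also have "measure lebesgue T = measure lborel T"
      using T(1) by (simp add: measure_completion compact_imp_closed)
    finally show ?thesis using T(3) a by simp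
  qed
  obtain \<Lambda> where \<Lambda>: "uniformly_discrete \<Lambda>" "has_uniform_density \<Lambda> 1"
     "\<And>g D. \<lbrakk>continuous_on UNIV g; \<And>y. (1 + y\<^sup>2) * norm (g y) \<le> D;
      \<And>t (k::int). t \<in> C \<Longrightarrow> (\<integral>y. g y * circ (- ((t + of_int k) * y)) \<partial>lborel) = 0;
      \<And>l. l \<in> \<Lambda> \<Longrightarrow> g l = 0\<rbrakk> \<Longrightarrow> g = (\<lambda>_. 0)"
    using universal_uniqueness_set[OF C1 C2 C3] by blast
  have "uniqueness_set ((\<lambda>x. x / a) ` \<Lambda>) (Y_S S)"
    unfolding uniqueness_set_def
  proof (intro ballI impI)
    fix f assume f: "f \<in> Y_S S" and van: "\<forall>l\<in>(\<lambda>x. x / a) ` \<Lambda>. f l = 0"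
    from f obtain D where cont: "continuous_on UNIV f" and D: "\<And>x. (1 + x\<^sup>2) * norm (f x) \<le> D"
      and spec: "\<And>t. t \<notin> S \<Longrightarrow> fourier f t = 0"
      unfolding Y_S_def Y_def by auto
    \<comment> \<open>The transform of g at s is a times that of f at a s, so zeros at a t + a k
      become zeros at t + k, and samples of f on \<Lambda> / a become samples of g on
      \<Lambda>.\<close>
    define g where "g x = f (x / a)" for x
    have "g = (\<lambda>_. 0)"
    proof (rule \<Lambda>(3))
      show "continuous_on UNIV g"
        unfolding g_def using a by (intro continuous_on_compose2[OF cont] continuous_intros) auto
      show "(1 + y\<^sup>2) * norm (g y) \<le> max 1 (a\<^sup>2) * D" for y
      proof -
        have "1 + y\<^sup>2 = 1 + a\<^sup>2 * (y / a)\<^sup>2" using a by (simp add: power_divide)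
        also have "\<dots> \<le> max 1 (a\<^sup>2) * 1 + max 1 (a\<^sup>2) * (y / a)\<^sup>2"
          by (intro add_mono mult_right_mono) auto
        finally have "1 + y\<^sup>2 \<le> max 1 (a\<^sup>2) * (1 + (y / a)\<^sup>2)" by (simp only: distrib_left)
        then have "(1 + y\<^sup>2) * norm (g y) \<le> max 1 (a\<^sup>2) * (1 + (y / a)\<^sup>2) * norm (g y)"
          by (intro mult_right_mono) auto
        also have "\<dots> \<le> max 1 (a\<^sup>2) * D"
          unfolding mult.assoc g_def by (intro mult_left_mono D) auto
        finally show ?thesis .
      qed
      show "g l = 0" if "l \<in> \<Lambda>" for l using van that by (auto simp: g_def)
      fix t and k :: int assume t: "t \<in> C"
      then have at: "a * t \<in> E" using T(2) a by (auto simp: C_def)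
      have "a * t + a * of_int k \<notin> S"
      proof
        assume "a * t + a * of_int k \<in> S"
        moreover have "a * t = (a * t + a * of_int k) + a * of_int (- k)" by simp
        moreover have "a * t \<in> {0..a}"
          using at unfolding E_def by (simp only: Diff_iff greaterThanLessThan_iff atLeastAtMost_iff less_imp_le)
        ultimately have "a * t \<in> periodization S a" unfolding periodization_def by blast
        with at show False by (simp add: E_def)
      qed
      then have "fourier f (a * (t + of_int k)) = 0" using spec by (simp add: distrib_left)
      then have "(\<integral>x. circ (- (a * (t + of_int k) * x)) * f x \<partial>lborel) = 0"
        unfolding fourier_def exp_eq_circ .
      moreover have "(\<integral>y. g y * circ (- ((t + of_int k) * y)) \<partial>lborel)
        = \<bar>a\<bar> *\<^sub>R (\<integral>x. g (0 + a * x) * circ (- ((t + of_int k) * (0 + a * x))) \<partial>lborel)"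
        by (rule lborel_integral_real_affine) (use a in simp)
      ultimately show "(\<integral>y. g y * circ (- ((t + of_int k) * y)) \<partial>lborel) = 0"
        using a by (simp add: g_def mult_ac)
    qed
    show "f = (\<lambda>_. 0)"
    proof
      fix x
      have "f x = g (a * x)" using a by (simp add: g_def)
      then show "f x = 0" by (simp add: \<open>g = (\<lambda>_. 0)\<close>)
    qed
  qed
  moreover have "uniformly_discrete ((\<lambda>x. x / a) ` \<Lambda>)"
    by (rule uniformly_discrete_scale[OF \<Lambda>(1) a])
  moreover have "has_uniform_density ((\<lambda>x. x / a) ` \<Lambda>) a"
    using has_uniform_density_scale[OF \<Lambda>(2) a] by simp
  ultimately show ?thesis by blast
qed

end
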